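(* Let $m,n$ be positive integers, let $\mathbf A\in\mathbb R_+^{m\times n}$, $\mathbf c\in\mathbb R_+^n$, $\bar d>0$, $\mathbf d=\bar d\,\mathbf e\in\mathbb R^n_+$, and let $\mathcal U=\{\mathbf h\in\mathbb R^m_+ : \mathbf R\mathbf h\le \mathbf r\}$ with $\mathbf R\in\mathbb R_+^{L\times m}$, $\mathbf r\in\mathbb R_+^L$, be a compact polyhedral uncertainty set. Suppose the entries of the random matrix $\tilde{\mathbf B}\in\mathbb R_+^{m\times n}$ are $\tilde B_{ij}=|\tilde G_{ij}|$, where the $\tilde G_{ij}$ are i.i.d. standard Gaussian random variables. Then there is a quantity $\kappa=O\left(\sqrt{\log m+\log n}\right)$ such that for $n$ and $m$ sufficiently large, with probability at least $1-\frac1m$, $$z_{\sf AR}(\tilde{\mathbf B})\le z_{\sf Aff}(\tilde{\mathbf B})\le \kappa\cdot z_{\sf AR}(\tilde{\mathbf B}).$$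
   Context: For data $\mathbf A,\mathbf B\in\mathbb R_+^{m\times n}$, $\mathbf c,\mathbf d\in\mathbb R_+^n$ and a compact convex set $\mathcal U\subseteq\mathbb R^m_+$, the two-stage adjustable robust problem is $$z_{\sf AR}(\mathbf B)=\min_{\mathbf x\in\mathbb R^n_+}\ \mathbf c^T\mathbf x+\max_{\mathbf h\in\mathcal U}\ \min_{\mathbf y(\mathbf h)\in\mathbb R^n_+:\ \mathbf A\mathbf x+\mathbf B\mathbf y(\mathbf h)\ge \mathbf h}\ \mathbf d^T\mathbf y(\mathbf h),$$ i.e. the second-stage decision $\mathbf y(\mathbf h)$ may depend arbitrarily on $\mathbf h$. The affine policy problem $z_{\sf Aff}(\mathbf B)$ is the same problem with the second-stage decision restricted to $\mathbf y(\mathbf h)=\mathbf P\mathbf h+\mathbf q$ for some $\mathbf P\in\mathbb R^{n\times m}$, $\mathbf q\in\mathbb R^n$: it is the minimum over $\mathbf x\in\mathbb R^n_+,\mathbf P,\mathbf q$ of $\mathbf c^T\mathbf x+\max_{\mathbf h\in\mathcal U}\mathbf d^T(\mathbf P\mathbf h+\mathbf q)$ subject to $\mathbf A\mathbf x+\mathbf B(\mathbf P\mathbf h+\mathbf q)\ge\mathbf h$ and $\mathbf P\mathbf h+\mathbf q\ge\mathbf 0$ for all $\mathbf h\in\mathcal U$. Here $\mathbf e$ denotes the all-ones vector; $\mathbf A,\mathbf c,\mathbf d,\mathcal U$ are fixed and only $\mathbf B$ is random. The $O(\cdot)$ hides an absolute constant independent of $m,n$ and of the instance. *)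

theory Defs
  imports "HOL-Probability.Probability"
begin

text \<open>Matrices are functions nat => nat => real; an m x n matrix M is used via M i j
 with i < m, j < n. Vectors are functions nat => real, used on indices below their dimension.\<close>

definition polyU :: "nat \<Rightarrow> nat \<Rightarrow> (nat \<Rightarrow> nat \<Rightarrow> real) \<Rightarrow> (nat \<Rightarrow> real) \<Rightarrow> (nat \<Rightarrow> real) set" where
  "polyU m L R r = {h. (\<forall>i<m. 0 \<le> h i) \<and> (\<forall>i. m \<le> i \<longrightarrow> h i = 0) \<and>
                      (\<forall>l<L. (\<Sum>i<m. R l i * h i) \<le> r l)}"

text \<open>Second-stage value: min { d^T y : y >= 0, A x + B y >= h } (infinity if infeasible).\<close>
definition second_stage :: "nat \<Rightarrow> nat \<Rightarrow> (nat \<Rightarrow> nat \<Rightarrow> real) \<Rightarrow> (nat \<Rightarrow> nat \<Rightarrow> real) \<Rightarrow>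
    (nat \<Rightarrow> real) \<Rightarrow> (nat \<Rightarrow> real) \<Rightarrow> (nat \<Rightarrow> real) \<Rightarrow> ereal" where
  "second_stage m n A B d x h =
     (INF y \<in> {y. (\<forall>j<n. 0 \<le> y j) \<and>
                 (\<forall>i<m. (\<Sum>j<n. A i j * x j) + (\<Sum>j<n. B i j * y j) \<ge> h i)}.
        ereal (\<Sum>j<n. d j * y j))"

definition zAR :: "nat \<Rightarrow> nat \<Rightarrow> (nat \<Rightarrow> nat \<Rightarrow> real) \<Rightarrow> (nat \<Rightarrow> nat \<Rightarrow> real) \<Rightarrow>
    (nat \<Rightarrow> real) \<Rightarrow> (nat \<Rightarrow> real) \<Rightarrow> (nat \<Rightarrow> real) set \<Rightarrow> ereal" where
  "zAR m n A B c d U =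
     (INF x \<in> {x. \<forall>j<n. 0 \<le> x j}.
        ereal (\<Sum>j<n. c j * x j) + (SUP h \<in> U. second_stage m n A B d x h))"

definition zAff :: "nat \<Rightarrow> nat \<Rightarrow> (nat \<Rightarrow> nat \<Rightarrow> real) \<Rightarrow> (nat \<Rightarrow> nat \<Rightarrow> real) \<Rightarrow>
    (nat \<Rightarrow> real) \<Rightarrow> (nat \<Rightarrow> real) \<Rightarrow> (nat \<Rightarrow> real) set \<Rightarrow> ereal" where
  "zAff m n A B c d U =
     (INF (x, P, q) \<in> {(x, P, q). (\<forall>j<n. 0 \<le> x j) \<and>
          (\<forall>h\<in>U. (\<forall>i<m. (\<Sum>j<n. A i j * x j) +
                      (\<Sum>j<n. B i j * ((\<Sum>k<m. P j k * h k) + q j)) \<ge> h i) \<and>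
                   (\<forall>j<n. (\<Sum>k<m. P j k * h k) + q j \<ge> 0))}.
        ereal (\<Sum>j<n. c j * x j) +
        (SUP h \<in> U. ereal (\<Sum>j<n. d j * ((\<Sum>k<m. P j k * h k) + q j))))"

definition gauss_matrix :: "nat \<Rightarrow> nat \<Rightarrow> (nat \<times> nat \<Rightarrow> real) measure" where
  "gauss_matrix m n = PiM ({..<m} \<times> {..<n}) (\<lambda>_. density lborel std_normal_density)"

end

theory Submission
  imports Defs
begin

text \<open>
Write \<open>B i j = \<bar>G (i, j)\<bar>\<close>, let \<open>a i\<close> and \<open>s i\<close> be the maximum and the average of row \<open>i\<close>, and let
\<open>x\<close> be a first-stage decision of total cost at most \<open>z\<close>. Then \<open>h i - (A x) i \<le> a i * z / dbar\<close> for all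
\<open>h\<close> in the uncertainty set, and a static second stage (\<open>P = 0\<close>) already has cost \<open>O(sqrt (ln m + ln n)) * z\<close>.
With high probability all entries are \<open>O(sqrt (ln m + ln n))\<close>.

If \<open>ln m \<le> n\<close>, all averages \<open>s i\<close> are bounded below and a constant vector is good enough. If
\<open>n\<^sup>2 \<le> ln m\<close>, the vector with all entries \<open>z / dbar\<close> costs only \<open>n * z\<close>.

If \<open>n \<le> ln m \<le> n\<^sup>2\<close>, some rows have a small average compared with their requirement, but there are
only \<open>O(ln m / n)\<close>, hence \<open>O(sqrt (ln m))\<close>, of them: a requirement profile for which many rows are
likely to be deficient is one for which some row is very likely to violate the bound by \<open>a i\<close>, because
both \<open>P(s i < \<beta> / \<kappa>)\<close> and \<open>P(a i < \<beta>)\<close> scale like \<open>\<beta> ^ n\<close>. The deficient rows are served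
separately, each at cost \<open>z\<close>. Since \<open>x\<close> depends on \<open>B\<close>, a union bound is needed: enlarging \<open>x\<close> by a
factor \<open>O(sqrt (ln m))\<close> leaves only \<open>2 ^ n\<close> candidates up to the scale \<open>z\<close>, and the requirements are
monotone in that scale.
\<close>

section \<open>Gaussian matrices\<close>

lemma prob_space_std_normal: "prob_space (density lborel std_normal_density)"
  by (rule prob_space_normal_density) simp

text \<open>Compare with the normal density of variance 2: the ratio is
  \<open>sqrt 2 * exp (- x\<^sup>2 / 4)\<close>, which on the tail is at most its value at
  \<open>t\<close>, and the wider density has total mass 1.\<close>

lemma std_normal_tail:
  assumes "0 \<le> t"
  shows "measure (density lborel std_normal_density) {x. t < \<bar>x\<bar>} \<le> sqrt 2 * exp (- t\<^sup>2 / 4)"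
proof -
  have ptw: "ennreal (std_normal_density x) * indicator {x. t < \<bar>x\<bar>} x
      \<le> ennreal (sqrt 2 * exp (- t\<^sup>2 / 4)) * ennreal (normal_density 0 (sqrt 2) x)" for x
  proof (cases "t < \<bar>x\<bar>")
    case True
    have eq: "std_normal_density x = sqrt 2 * exp (- x\<^sup>2 / 4) * normal_density 0 (sqrt 2) x"
      unfolding normal_density_def
      by (simp add: real_sqrt_mult field_simps flip: exp_add)
    have "t\<^sup>2 \<le> x\<^sup>2"
      using True assms by (metis abs_ge_zero less_imp_le power2_abs power_mono)
    then have "std_normal_density x \<le> sqrt 2 * exp (- t\<^sup>2 / 4) * normal_density 0 (sqrt 2) x"
      unfolding eq by (intro mult_right_mono mult_left_mono) auto
    then show ?thesis
      using True by (simp add: ennreal_mult[symmetric] ennreal_leI)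
  qed simp
  have one: "(\<integral>\<^sup>+x. ennreal (normal_density 0 (sqrt 2) x) \<partial>lborel) = 1"
    using prob_space.emeasure_space_1[OF prob_space_normal_density[of "sqrt 2" 0]]
    by (simp add: emeasure_density)
  have "emeasure (density lborel std_normal_density) {x. t < \<bar>x\<bar>}
      = (\<integral>\<^sup>+x. ennreal (std_normal_density x) * indicator {x. t < \<bar>x\<bar>} x \<partial>lborel)"
    by (subst emeasure_density) auto
  also have "\<dots> \<le> (\<integral>\<^sup>+x. ennreal (sqrt 2 * exp (- t\<^sup>2 / 4)) * ennreal (normal_density 0 (sqrt 2) x) \<partial>lborel)"
    by (intro nn_integral_mono ptw)
  also have "\<dots> = ennreal (sqrt 2 * exp (- t\<^sup>2 / 4))"
    by (subst nn_integral_cmult) (auto simp: one)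
  finally show ?thesis
    by (simp add: measure_def enn2real_leI)
qed

text \<open>The density is at least 1/6 on (-1, 1), so radius \<open>a = min b 1\<close> carries
  mass at least \<open>a / 3\<close>, and \<open>b / K \<le> a\<close>. The bound is linear in
  \<open>b\<close> on all of [0, \<open>K\<close>], so that row probabilities later scale like
  \<open>b ^ n\<close> up to the truncation level \<open>K\<close>.\<close>

lemma std_normal_small_ball:
  assumes "0 \<le> b" "b \<le> K" "1 \<le> K"
  shows "b / (3 * K) \<le> measure (density lborel std_normal_density) {x. \<bar>x\<bar> < b}"
proof -
  interpret prob_space "density lborel std_normal_density"
    by (rule prob_space_std_normal)
  define a where "a = min b 1"
  have a: "0 \<le> a" "a \<le> 1" "a \<le> b" "b / K \<le> a"
    using assms mult_left_mono[of 1 K b] by (auto simp: a_def min_def field_simps)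
  have dens: "1 / 6 \<le> std_normal_density x" if "\<bar>x\<bar> < a" for x
  proof -
    have "x\<^sup>2 \<le> 1"
      using that a by (simp add: abs_square_le_1)
    then have "1 / 2 \<le> exp (- x\<^sup>2 / 2)"
      using exp_ge_add_one_self[of "- x\<^sup>2 / 2"] by linarith
    moreover have "sqrt (2 * pi) \<le> 3"
      using pi_less_4 by (intro real_le_lsqrt) auto
    then have "1 / 3 \<le> 1 / sqrt (2 * pi)"
      by (simp add: field_simps)
    ultimately have "(1 / 3) * (1 / 2) \<le> (1 / sqrt (2 * pi)) * exp (- x\<^sup>2 / 2)"
      by (intro mult_mono) auto
    then show ?thesis by (simp add: std_normal_density_def)
  qed
  have "ennreal (a / 3) = ennreal (1/6) * emeasure lborel {-a<..<a}"
    using a by (simp add: ennreal_mult[symmetric])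
  also have "\<dots> = (\<integral>\<^sup>+x. ennreal (1/6) * indicator {-a<..<a} x \<partial>lborel)"
    by (subst nn_integral_cmult) auto
  also have "\<dots> \<le> (\<integral>\<^sup>+x. ennreal (std_normal_density x) * indicator {x. \<bar>x\<bar> < b} x \<partial>lborel)"
    using dens a by (intro nn_integral_mono) (auto simp: indicator_def intro!: ennreal_leI)
  also have "\<dots> = emeasure (density lborel std_normal_density) {x. \<bar>x\<bar> < b}"
    by (subst emeasure_density) auto
  finally have "a / 3 \<le> prob {x. \<bar>x\<bar> < b}"
    using a by (simp add: emeasure_eq_measure)
  moreover have "b / (3 * K) \<le> a / 3"
    using a(4) by (simp add: field_simps)
  ultimately show ?thesis by linarith
qed

text \<open>The density is at most 1/2 and \<open>exp (- l * \<bar>x\<bar>)\<close> has integral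
  \<open>2 / l\<close> over the line; its two halves are integrated as exponential densities in
  \<open>x\<close> and \<open>- x\<close>.\<close>

lemma std_normal_laplace_transform:
  assumes "0 < (l::real)"
  shows "(\<integral>\<^sup>+x. ennreal (exp (- l * \<bar>x\<bar>)) \<partial>density lborel std_normal_density) \<le> ennreal (1 / l)"
proof -
  let ?e = "exponential_density l"
  have one: "(\<integral>\<^sup>+x. ennreal (?e x) \<partial>lborel) = 1"
    using prob_space.emeasure_space_1[OF prob_space_exponential_density[OF assms]]
    by (simp add: emeasure_density)
  have one': "(\<integral>\<^sup>+x. ennreal (?e (- x)) \<partial>lborel) = 1"
    using nn_integral_real_affine[of "\<lambda>x. ennreal (?e x)" "-1" 0] one by simp
  have d: "std_normal_density x \<le> 1 / 2" for x
  proof -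
    have "2 \<le> sqrt (2 * pi)"
      using pi_gt3 by (intro real_le_rsqrt) auto
    then have "1 / sqrt (2 * pi) \<le> 1 / 2"
      by (simp add: field_simps)
    moreover have "exp (- x\<^sup>2 / 2) \<le> 1" by simp
    ultimately have "1 / sqrt (2 * pi) * exp (- x\<^sup>2 / 2) \<le> 1 / 2 * 1"
      by (intro mult_mono) auto
    then show ?thesis by (simp add: std_normal_density_def)
  qed
  have ptw: "ennreal (std_normal_density x) * ennreal (exp (- l * \<bar>x\<bar>))
     \<le> ennreal (1 / (2 * l)) * (ennreal (?e x) + ennreal (?e (- x)))" for x
  proof -
    have "std_normal_density x * exp (- l * \<bar>x\<bar>) \<le> 1 / 2 * exp (- l * \<bar>x\<bar>)"
      by (intro mult_right_mono d) auto
    also have "\<dots> \<le> 1 / (2 * l) * (?e x + ?e (- x))"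
      using assms by (auto simp: exponential_density_def field_simps abs_if)
    finally show ?thesis
      using assms exponential_density_nonneg[OF assms]
      by (auto simp: ennreal_mult[symmetric] ennreal_plus[symmetric] intro!: ennreal_leI simp del: ennreal_plus)
  qed
  have "(\<integral>\<^sup>+x. ennreal (exp (- l * \<bar>x\<bar>)) \<partial>density lborel std_normal_density)
      = (\<integral>\<^sup>+x. ennreal (std_normal_density x) * ennreal (exp (- l * \<bar>x\<bar>)) \<partial>lborel)"
    by (subst nn_integral_density) auto
  also have "\<dots> \<le> (\<integral>\<^sup>+x. ennreal (1 / (2 * l)) * (ennreal (?e x) + ennreal (?e (- x))) \<partial>lborel)"
    by (intro nn_integral_mono ptw)
  also have "\<dots> = ennreal (1 / (2 * l)) * (1 + 1)"
    by (subst nn_integral_cmult) (auto simp: nn_integral_add one one')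
  also have "\<dots> = ennreal (1 / (2 * l)) * ennreal 2" by (simp flip: ennreal_numeral)
  also have "\<dots> = ennreal (1 / l)"
    using assms by (subst ennreal_mult[symmetric]) auto
  finally show ?thesis .
qed

section \<open>Independence and union bounds for the matrix entries\<close>

lemma prob_space_gauss_matrix: "prob_space (gauss_matrix m n)"
  unfolding gauss_matrix_def by (intro prob_space_PiM prob_space_std_normal)

lemma gauss_matrix_entry_measurable:
  "i < m \<Longrightarrow> j < n \<Longrightarrow> (\<lambda>G. G (i, j)) \<in> borel_measurable (gauss_matrix m n)"
  unfolding gauss_matrix_def
  using measurable_component_singleton[of "(i, j)" "{..<m} \<times> {..<n}" "\<lambda>_. density lborel std_normal_density"]
  by simp

lemma gauss_matrix_entry_distr:
  assumes "i < m" "j < n"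
  shows "distr (gauss_matrix m n) (density lborel std_normal_density) (\<lambda>G. G (i, j))
    = density lborel std_normal_density"
  unfolding gauss_matrix_def
  using distr_PiM_component[of "{..<m} \<times> {..<n}" "\<lambda>_. density lborel std_normal_density" "(i, j)"]
    prob_space_std_normal assms by simp

lemma gauss_matrix_entry_measure:
  assumes "i < m" "j < n" "S \<in> sets borel"
  shows "measure (gauss_matrix m n) {G \<in> space (gauss_matrix m n). G (i, j) \<in> S}
    = measure (density lborel std_normal_density) S"
proof -
  have "measure (density lborel std_normal_density) S =
      measure (distr (gauss_matrix m n) (density lborel std_normal_density) (\<lambda>G. G (i, j))) S"
    using gauss_matrix_entry_distr[OF assms(1,2)] by simp
  also have "\<dots> = measure (gauss_matrix m n) ((\<lambda>G. G (i, j)) -` S \<inter> space (gauss_matrix m n))"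
    using gauss_matrix_entry_measurable[OF assms(1,2)] assms(3)
    by (intro measure_distr) (auto simp: measurable_def)
  finally show ?thesis
    by (simp add: vimage_def Int_def conj_commute)
qed

text \<open>The tuple of coordinates is the identity map of the product space, so its law is the
  product of the marginal laws, which is equivalent to independence.\<close>

lemma gauss_matrix_indep_entries:
  assumes "0 < m" "0 < n"
  shows "prob_space.indep_vars (gauss_matrix m n) (\<lambda>_. density lborel std_normal_density)
    (\<lambda>k G. G k) ({..<m} \<times> {..<n})"
proof -
  interpret prob_space "gauss_matrix m n" by (rule prob_space_gauss_matrix)
  let ?I = "{..<m} \<times> {..<n}" and ?N = "density lborel std_normal_density"
  have "distr (gauss_matrix m n) (PiM ?I (\<lambda>_. ?N)) (\<lambda>x. \<lambda>i\<in>?I. x i)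
     = distr (gauss_matrix m n) (gauss_matrix m n) (\<lambda>x. x)"
    unfolding gauss_matrix_def
    by (intro distr_cong) (auto simp: space_PiM PiE_restrict)
  also have "\<dots> = PiM ?I (\<lambda>_. ?N)"
    by (simp add: distr_id gauss_matrix_def)
  also have "\<dots> = PiM ?I (\<lambda>i. distr (gauss_matrix m n) ?N (\<lambda>x. x i))"
    by (intro PiM_cong) (auto simp: gauss_matrix_entry_distr)
  finally show ?thesis
    using assms gauss_matrix_entry_measurable
    by (subst indep_vars_iff_distr_eq_PiM') (auto simp: measurable_def)
qed

lemma gauss_matrix_row_small_ball:
  assumes "0 < m" "0 < n" "i < m" "0 \<le> b" "b \<le> K" "1 \<le> K"
  shows "(b / (3 * K)) ^ n \<le>
    measure (gauss_matrix m n) {G \<in> space (gauss_matrix m n). \<forall>j<n. \<bar>G (i, j)\<bar> < b}"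
proof -
  interpret prob_space "gauss_matrix m n" by (rule prob_space_gauss_matrix)
  let ?M = "gauss_matrix m n" and ?N = "density lborel std_normal_density"
  have "prob (\<Inter>k\<in>{i} \<times> {..<n}. (\<lambda>G. G k) -` {x. \<bar>x\<bar> < b} \<inter> space ?M)
     = (\<Prod>k\<in>{i} \<times> {..<n}. prob ((\<lambda>G. G k) -` {x. \<bar>x\<bar> < b} \<inter> space ?M))"
    using assms by (intro indep_varsD[OF gauss_matrix_indep_entries]) auto
  also have "\<dots> = (\<Prod>k\<in>{i} \<times> {..<n}. measure ?N {x. \<bar>x\<bar> < b})"
  proof (intro prod.cong refl)
    fix k assume "k \<in> {i} \<times> {..<n}"
    then show "prob ((\<lambda>G. G k) -` {x. \<bar>x\<bar> < b} \<inter> space ?M) = measure ?N {x. \<bar>x\<bar> < b}"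
      using gauss_matrix_entry_measure[of i m "snd k" n "{x. \<bar>x\<bar> < b}"] assms
      by (auto simp: vimage_def Int_def conj_commute)
  qed
  also have "\<dots> = measure ?N {x. \<bar>x\<bar> < b} ^ n" by simp
  also have "(\<Inter>k\<in>{i} \<times> {..<n}. (\<lambda>G. G k) -` {x. \<bar>x\<bar> < b} \<inter> space ?M)
     = {G \<in> space ?M. \<forall>j<n. \<bar>G (i, j)\<bar> < b}"
    using assms by auto
  finally show ?thesis
    using std_normal_small_ball[OF assms(4-6)] assms by (simp add: power_mono)
qed

text \<open>Rows are independent blocks, and a row of small-ball probability at least
  \<open>p\<close> avoids being small with probability at most \<open>1 - p \<le> exp (- p)\<close>.
  The product over the rows becomes a sum in the exponent.\<close>

lemma gauss_matrix_no_small_row: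
  assumes "0 < m" "0 < n" "\<And>i. i < m \<Longrightarrow> 0 \<le> b i \<and> b i \<le> K" "1 \<le> K"
  shows "measure (gauss_matrix m n) {G \<in> space (gauss_matrix m n). \<forall>i<m. \<exists>j<n. b i \<le> \<bar>G (i, j)\<bar>}
    \<le> exp (- (\<Sum>i<m. (b i / (3 * K)) ^ n))"
proof -
  interpret prob_space "gauss_matrix m n" by (rule prob_space_gauss_matrix)
  let ?M = "gauss_matrix m n" and ?N = "density lborel std_normal_density"
  let ?row = "\<lambda>i. {i} \<times> {..<n}"
  let ?X = "\<lambda>i \<omega>. restrict (\<lambda>k. \<omega> k) (?row i)"
  let ?A = "\<lambda>i. {g \<in> space (PiM (?row i) (\<lambda>_. ?N)). \<exists>j<n. b i \<le> \<bar>g (i, j)\<bar>}"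
  have ind: "indep_vars (\<lambda>i. PiM (?row i) (\<lambda>_. ?N)) ?X {..<m}"
    by (rule indep_vars_restrict[OF gauss_matrix_indep_entries])
       (use assms in \<open>auto simp: disjoint_family_on_def\<close>)
  have A: "?A i \<in> sets (PiM (?row i) (\<lambda>_. ?N))" for i
  proof -
    have [measurable]: "(\<lambda>g. g (i, j)) \<in> borel_measurable (PiM (?row i) (\<lambda>_. ?N))" if "j < n" for j
      using measurable_component_singleton[of "(i, j)" "?row i" "\<lambda>_. ?N"] that by simp
    have "?A i = (\<Union>j\<in>{..<n}. {g \<in> space (PiM (?row i) (\<lambda>_. ?N)). b i \<le> \<bar>g (i, j)\<bar>})"
      by auto
    also have "\<dots> \<in> sets (PiM (?row i) (\<lambda>_. ?N))"
      by (intro sets.finite_UN) auto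
    finally show ?thesis .
  qed
  have pre: "?X i -` ?A i \<inter> space ?M = space ?M - {G \<in> space ?M. \<forall>j<n. \<bar>G (i, j)\<bar> < b i}"
    if "i < m" for i
  proof -
    have "?X i G \<in> space (PiM (?row i) (\<lambda>_. ?N))" for G
      by (simp add: space_PiM)
    then show ?thesis by (auto simp: not_less)
  qed
  have meas: "{G \<in> space ?M. \<forall>j<n. \<bar>G (i, j)\<bar> < b i} \<in> sets ?M" if "i < m" for i
  proof -
    have [measurable]: "(\<lambda>G. G (i, j)) \<in> borel_measurable ?M" if "j < n" for j
      using gauss_matrix_entry_measurable \<open>i < m\<close> that by blast
    have "{G \<in> space ?M. \<forall>j\<in>{..<n}. \<bar>G (i, j)\<bar> < b i} \<in> sets ?M"
      by (intro sets.sets_Collect_finite_All') (use assms in auto)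
    then show ?thesis by (simp add: Ball_def)
  qed
  have "{G \<in> space ?M. \<forall>i<m. \<exists>j<n. b i \<le> \<bar>G (i, j)\<bar>} = (\<Inter>i\<in>{..<m}. ?X i -` ?A i \<inter> space ?M)"
    using assms(1) by (auto simp: pre not_less not_le space_PiM)
  then have "prob {G \<in> space ?M. \<forall>i<m. \<exists>j<n. b i \<le> \<bar>G (i, j)\<bar>}
      = (\<Prod>i<m. prob (?X i -` ?A i \<inter> space ?M))"
    using indep_varsD[OF ind, of "{..<m}" ?A] A assms(1) by auto
  also have "\<dots> = (\<Prod>i<m. 1 - prob {G \<in> space ?M. \<forall>j<n. \<bar>G (i, j)\<bar> < b i})"
  proof (intro prod.cong refl)
    fix i assume "i \<in> {..<m}"
    then have "i < m" by simp
    show "prob (?X i -` ?A i \<inter> space ?M) = 1 - prob {G \<in> space ?M. \<forall>j<n. \<bar>G (i, j)\<bar> < b i}"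
      unfolding pre[OF \<open>i < m\<close>] by (rule prob_compl[OF meas[OF \<open>i < m\<close>]])
  qed
  also have "\<dots> \<le> (\<Prod>i<m. exp (- ((b i / (3 * K)) ^ n)))"
  proof (intro prod_mono conjI)
    fix i assume "i \<in> {..<m}"
    then have "(b i / (3 * K)) ^ n \<le> prob {G \<in> space ?M. \<forall>j<n. \<bar>G (i, j)\<bar> < b i}"
      using assms by (intro gauss_matrix_row_small_ball) auto
    then show "1 - prob {G \<in> space ?M. \<forall>j<n. \<bar>G (i, j)\<bar> < b i} \<le> exp (- ((b i / (3 * K)) ^ n))"
      using exp_ge_add_one_self[of "- ((b i / (3 * K)) ^ n)"] by linarith
  qed simp
  also have "\<dots> = exp (- (\<Sum>i<m. (b i / (3 * K)) ^ n))"
    by (simp add: exp_sum[symmetric] sum_negf)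
  finally show ?thesis .
qed

lemma gauss_matrix_no_small_row_measurable:
  "{G \<in> space (gauss_matrix m n). \<forall>i<m. \<exists>j<n. b i \<le> \<bar>G (i, j)\<bar>} \<in> sets (gauss_matrix m n)"
proof -
  let ?M = "gauss_matrix m n"
  have "{G \<in> space ?M. \<forall>i\<in>{..<m}. \<exists>j\<in>{..<n}. b i \<le> \<bar>G (i, j)\<bar>} \<in> sets ?M"
  proof (intro sets.sets_Collect_finite_All sets.sets_Collect_finite_Ex)
    fix i j assume "i \<in> {..<m}" "j \<in> {..<n}"
    then have [measurable]: "(\<lambda>G. G (i, j)) \<in> borel_measurable ?M"
      by (intro gauss_matrix_entry_measurable) auto
    show "{G \<in> space ?M. b i \<le> \<bar>G (i, j)\<bar>} \<in> sets ?M" by measurable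
  qed auto
  then show ?thesis by (simp only: Ball_def Bex_def lessThan_iff)
qed

lemma gauss_matrix_small_row_sums_measurable:
  assumes "Q \<subseteq> {..<m}"
  shows "{G \<in> space (gauss_matrix m n). \<forall>i\<in>Q. (\<Sum>j<n. \<bar>G (i, j)\<bar>) < e i} \<in> sets (gauss_matrix m n)"
proof (rule sets.sets_Collect_finite_All)
  fix i assume "i \<in> Q"
  then have "(\<lambda>G. \<Sum>j<n. \<bar>G (i, j)\<bar>) \<in> borel_measurable (gauss_matrix m n)"
    using gauss_matrix_entry_measurable assms
    by (intro borel_measurable_sum borel_measurable_abs) auto
  then show "{G \<in> space (gauss_matrix m n). (\<Sum>j<n. \<bar>G (i, j)\<bar>) < e i} \<in> sets (gauss_matrix m n)"
    by measurable
qed (use assms finite_subset in blast)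

text \<open>Chernoff bound with parameter \<open>1 / e i\<close> in row \<open>i\<close>: on the
  event the product of all \<open>exp (1 - \<bar>G (i, j)\<bar> / e i)\<close> is at least 1, and
  each factor has mean at most \<open>exp 1 * e i\<close> by the Laplace transform bound.\<close>

lemma gauss_matrix_small_row_sums:
  assumes Q: "Q \<subseteq> {..<m}" and e: "\<And>i. i \<in> Q \<Longrightarrow> 0 \<le> e i"
  shows "measure (gauss_matrix m n)
      {G \<in> space (gauss_matrix m n). \<forall>i\<in>Q. (\<Sum>j<n. \<bar>G (i, j)\<bar>) < real n * e i}
    \<le> (\<Prod>i\<in>Q. (exp 1 * e i) ^ n)"
proof (cases "\<forall>i\<in>Q. 0 < e i")
  \<comment> \<open>A zero threshold makes the event empty and has no Chernoff parameter
    \<open>1 / e i\<close>.\<close>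
  case False
  then obtain i where i: "i \<in> Q" "e i = 0" using e by force
  have "0 \<le> (\<Sum>j<n. \<bar>G (i, j)\<bar>)" for G :: "nat \<times> nat \<Rightarrow> real"
    by (intro sum_nonneg) auto
  then have empty: "{G \<in> space (gauss_matrix m n). \<forall>i\<in>Q. (\<Sum>j<n. \<bar>G (i, j)\<bar>) < real n * e i} = {}"
    using i by (auto simp: not_less intro!: bexI[of _ i])
  show ?thesis
    unfolding empty using e by (auto intro!: prod_nonneg)
next
  case pos: True
  let ?M = "gauss_matrix m n" and ?N = "density lborel std_normal_density"
  let ?I = "{..<m} \<times> {..<n}"
  let ?B = "{G \<in> space ?M. \<forall>i\<in>Q. (\<Sum>j<n. \<bar>G (i, j)\<bar>) < real n * e i}"
  have [simp]: "finite Q" using Q finite_subset by blast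
  \<comment> \<open>The factor 1 outside the rows in \<open>Q\<close> extends the product to all
    entries, so that the product formula for integrals over the whole product space applies.\<close>
  define f where "f = (\<lambda>(k::nat \<times> nat) (x::real). if fst k \<in> Q then exp (1 - \<bar>x\<bar> / e (fst k)) else (1::real))"
  have fprod: "(\<Prod>k\<in>?I. f k (G k)) = (\<Prod>i\<in>Q. exp (\<Sum>j<n. 1 - \<bar>G (i, j)\<bar> / e i))" for G
  proof -
    have "(\<Prod>k\<in>?I. f k (G k)) = (\<Prod>i<m. \<Prod>j<n. f (i, j) (G (i, j)))"
      by (simp add: prod.cartesian_product split_def)
    also have "\<dots> = (\<Prod>i<m. if i \<in> Q then exp (\<Sum>j<n. 1 - \<bar>G (i, j)\<bar> / e i) else 1)"
      by (intro prod.cong refl) (auto simp: f_def exp_sum)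
    also have "\<dots> = (\<Prod>i\<in>Q. exp (\<Sum>j<n. 1 - \<bar>G (i, j)\<bar> / e i))"
      using Q by (subst prod.inter_restrict[symmetric]) (auto simp: Int_absorb1)
    finally show ?thesis .
  qed
  have ind: "indicator ?B G \<le> (\<Prod>k\<in>?I. ennreal (f k (G k)))" for G
  proof (cases "G \<in> ?B")
    case True
    have "1 \<le> exp (\<Sum>j<n. 1 - \<bar>G (i, j)\<bar> / e i)" if "i \<in> Q" for i
    proof -
      have "(\<Sum>j<n. \<bar>G (i, j)\<bar>) / e i \<le> real n"
        using True that pos by (auto simp: field_simps)
      then show ?thesis
        by (simp add: sum_subtractf sum_divide_distrib)
    qed
    then have "1 \<le> (\<Prod>k\<in>?I. f k (G k))"
      unfolding fprod by (intro prod_ge_1) auto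
    moreover have "(\<Prod>k\<in>?I. ennreal (f k (G k))) = ennreal (\<Prod>k\<in>?I. f k (G k))"
      by (intro prod_ennreal) (auto simp: f_def)
    ultimately show ?thesis using True by simp
  qed simp
  interpret product_sigma_finite "\<lambda>_::nat \<times> nat. ?N"
    unfolding product_sigma_finite_def
    using prob_space_std_normal prob_space_imp_sigma_finite by blast
  interpret prob_space ?M by (rule prob_space_gauss_matrix)
  have B: "?B \<in> sets ?M"
    using Q by (rule gauss_matrix_small_row_sums_measurable)
  have fint: "(\<integral>\<^sup>+x. ennreal (f k x) \<partial>?N) \<le> ennreal (if fst k \<in> Q then exp 1 * e (fst k) else 1)" for k
  proof (cases "fst k \<in> Q")
    case True
    let ?l = "1 / e (fst k)"
    have l: "0 < ?l" using pos True by simp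
    have "(\<integral>\<^sup>+x. ennreal (f k x) \<partial>?N) = (\<integral>\<^sup>+x. ennreal (exp 1) * ennreal (exp (- ?l * \<bar>x\<bar>)) \<partial>?N)"
      using True by (intro nn_integral_cong) (simp add: f_def ennreal_mult[symmetric] flip: exp_add)
    also have "\<dots> = ennreal (exp 1) * (\<integral>\<^sup>+x. ennreal (exp (- ?l * \<bar>x\<bar>)) \<partial>?N)"
      by (rule nn_integral_cmult) simp
    also have "\<dots> \<le> ennreal (exp 1) * ennreal (1 / ?l)"
      by (intro mult_left_mono std_normal_laplace_transform l) simp
    finally show ?thesis
      using True pos by (simp add: ennreal_mult less_imp_le)
  next
    case False
    then show ?thesis
      using prob_space.emeasure_space_1[OF prob_space_std_normal] by (simp add: f_def)
  qed
  have "emeasure ?M ?B = (\<integral>\<^sup>+G. indicator ?B G \<partial>?M)"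
    using B by simp
  also have "\<dots> \<le> (\<integral>\<^sup>+G. (\<Prod>k\<in>?I. ennreal (f k (G k))) \<partial>?M)"
    by (intro nn_integral_mono ind)
  also have "\<dots> = (\<Prod>k\<in>?I. \<integral>\<^sup>+x. ennreal (f k x) \<partial>?N)"
    unfolding gauss_matrix_def
    by (rule product_nn_integral_prod) (auto simp: f_def)
  also have "\<dots> \<le> (\<Prod>k\<in>?I. ennreal (if fst k \<in> Q then exp 1 * e (fst k) else 1))"
    by (intro prod_mono_ennreal fint)
  also have "\<dots> = ennreal (\<Prod>k\<in>?I. if fst k \<in> Q then exp 1 * e (fst k) else 1)"
    by (intro prod_ennreal) (use pos in \<open>auto intro: less_imp_le\<close>)
  also have "(\<Prod>k\<in>?I. if fst k \<in> Q then exp 1 * e (fst k) else 1) = (\<Prod>i\<in>Q. (exp 1 * e i) ^ n)"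
  proof -
    have "(\<Prod>k\<in>?I. if fst k \<in> Q then exp 1 * e (fst k) else 1)
        = (\<Prod>i<m. \<Prod>j<n. if i \<in> Q then exp 1 * e i else 1)"
      by (simp only: prod.cartesian_product split_def)
    also have "\<dots> = (\<Prod>i<m. if i \<in> Q then (exp 1 * e i) ^ n else 1)"
      by (intro prod.cong refl) auto
    also have "\<dots> = (\<Prod>i\<in>Q. (exp 1 * e i) ^ n)"
      using Q by (subst prod.inter_restrict[symmetric]) (auto simp: Int_absorb1)
    finally show ?thesis .
  qed
  finally have "ennreal (prob ?B) \<le> ennreal (\<Prod>i\<in>Q. (exp 1 * e i) ^ n)"
    by (simp add: emeasure_eq_measure)
  moreover have "0 \<le> (\<Prod>i\<in>Q. (exp 1 * e i) ^ n)"
    using e by (intro prod_nonneg) auto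
  ultimately show ?thesis by simp
qed

text \<open>The constant 12 makes \<open>t\<^sup>2 / 4\<close> equal to three times the logarithm of
  \<open>m * n\<close>. One entry then exceeds \<open>t\<close> with probability at most
  \<open>sqrt 2 / (m * n) ^ 3\<close>, and the union bound over all entries costs one power.\<close>

lemma gauss_matrix_entries_bounded:
  assumes "0 < m" "0 < n" and t: "t = sqrt (12 * (ln (real m) + ln (real n)))"
  shows "measure (gauss_matrix m n)
      {G \<in> space (gauss_matrix m n). \<exists>i<m. \<exists>j<n. t < \<bar>G (i, j)\<bar>} \<le> sqrt 2 / (real m * real n)\<^sup>2"
    (is "measure ?M ?B \<le> _")
    and "{G \<in> space (gauss_matrix m n). \<exists>i<m. \<exists>j<n. t < \<bar>G (i, j)\<bar>} \<in> sets (gauss_matrix m n)"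
proof -
  interpret prob_space ?M by (rule prob_space_gauss_matrix)
  let ?S = "\<lambda>k. {G \<in> space ?M. G k \<in> {x. t < \<bar>x\<bar>}}"
  have eq: "?B = (\<Union>k\<in>{..<m} \<times> {..<n}. ?S k)"
    by auto
  have sets: "?S k \<in> sets ?M" if "k \<in> {..<m} \<times> {..<n}" for k
  proof -
    have [measurable]: "(\<lambda>G. G k) \<in> borel_measurable ?M"
      using gauss_matrix_entry_measurable[of "fst k" m "snd k" n] that by auto
    show ?thesis by simp
  qed
  then show "?B \<in> sets ?M" unfolding eq by (intro sets.finite_UN) auto
  have ln: "0 \<le> ln (real m) + ln (real n)"
    using assms by simp
  have tail: "prob (?S k) \<le> sqrt 2 / (real m * real n) ^ 3" if "k \<in> {..<m} \<times> {..<n}" for k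
  proof -
    have "prob (?S k) \<le> sqrt 2 * exp (- t\<^sup>2 / 4)"
      using gauss_matrix_entry_measure[of "fst k" m "snd k" n "{x. t < \<bar>x\<bar>}"] that
        std_normal_tail[of t] ln t by auto
    also have "- t\<^sup>2 / 4 = - (3 * (ln (real m) + ln (real n)))"
      using ln t by simp
    also have "exp (- (3 * (ln (real m) + ln (real n)))) = 1 / (real m * real n) ^ 3"
    proof -
      have "exp (3 * (ln (real m) + ln (real n))) = (real m * real n) ^ 3"
        using assms exp_of_nat_mult[of 3 "ln (real m) + ln (real n)"] by (simp add: exp_add)
      then show ?thesis
        by (simp only: exp_minus inverse_eq_divide)
    qed
    finally show ?thesis by simp
  qed
  have "prob ?B \<le> (\<Sum>k\<in>{..<m} \<times> {..<n}. prob (?S k))"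
    unfolding eq using sets by (intro finite_measure_subadditive_finite) auto
  also have "\<dots> \<le> (\<Sum>k\<in>{..<m} \<times> {..<n}. sqrt 2 / (real m * real n) ^ 3)"
    by (intro sum_mono tail)
  also have "\<dots> = sqrt 2 / (real m * real n)\<^sup>2"
    using assms by (simp add: card_cartesian_product power2_eq_square power3_eq_cube)
  finally show "prob ?B \<le> sqrt 2 / (real m * real n)\<^sup>2" .
qed

section \<open>Adjustable and static policies\<close>

lemma zero_in_polyU: "(\<forall>l<L. 0 \<le> r l) \<Longrightarrow> (\<lambda>_. 0) \<in> polyU m L R r"
  by (simp add: polyU_def)

text \<open>Compactness refers to the product topology, in which evaluation at a coordinate is
  continuous.\<close>

lemma polyU_coordinate_bounded:
  assumes "compact (polyU m L R r)"
  shows "bdd_above ((\<lambda>h. h i) ` polyU m L R r)"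
proof -
  have "continuous_on (polyU m L R r) (\<lambda>h. h i)"
    by (rule continuous_on_subset[OF continuous_on_product_coordinates]) simp
  then have "compact ((\<lambda>h. h i) ` polyU m L R r)"
    using assms by (rule compact_continuous_image)
  then show ?thesis
    by (intro bounded_imp_bdd_above compact_imp_bounded)
qed

text \<open>For fixed \<open>x\<close>, the value of a feasible affine rule at \<open>h\<close> is
  one admissible recourse for \<open>h\<close>.\<close>

lemma zAR_le_zAff: "zAR m n A B c d U \<le> zAff m n A B c d U"
  unfolding zAff_def
proof (rule INF_greatest, clarify)
  fix x P q
  assume x: "\<forall>j<n. 0 \<le> x j"
    and f: "\<forall>h\<in>U. (\<forall>i<m. h i \<le> (\<Sum>j<n. A i j * x j) +
             (\<Sum>j<n. B i j * ((\<Sum>k<m. P j k * h k) + q j))) \<and>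
           (\<forall>j<n. 0 \<le> (\<Sum>k<m. P j k * h k) + q j)"
  have "second_stage m n A B d x h \<le> ereal (\<Sum>j<n. d j * ((\<Sum>k<m. P j k * h k) + q j))"
    if "h \<in> U" for h
    unfolding second_stage_def using f that
    by (intro INF_lower2[of "\<lambda>j. (\<Sum>k<m. P j k * h k) + q j"]) auto
  then have "(SUP h\<in>U. second_stage m n A B d x h)
      \<le> (SUP h\<in>U. ereal (\<Sum>j<n. d j * ((\<Sum>k<m. P j k * h k) + q j)))"
    by (rule SUP_subset_mono[OF order_refl])
  then show "zAR m n A B c d U \<le> ereal (\<Sum>j<n. c j * x j) +
      (SUP h\<in>U. ereal (\<Sum>j<n. d j * ((\<Sum>k<m. P j k * h k) + q j)))"
    unfolding zAR_def using x
    by (intro INF_lower2[of x] add_left_mono) auto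
qed

text \<open>Choose \<open>P = 0\<close>; the second-stage cost is then the same for every
  \<open>h\<close>. All upper bounds on the affine value come from here.\<close>

lemma zAff_le_static:
  assumes "\<And>j. j < n \<Longrightarrow> 0 \<le> x j" "\<And>j. j < n \<Longrightarrow> 0 \<le> q j"
    and "\<And>h i. h \<in> U \<Longrightarrow> i < m \<Longrightarrow> h i \<le> (\<Sum>j<n. A i j * x j) + (\<Sum>j<n. B i j * q j)"
  shows "zAff m n A B c (\<lambda>_. dbar) U \<le> ereal ((\<Sum>j<n. c j * x j) + dbar * (\<Sum>j<n. q j))"
proof -
  have "zAff m n A B c (\<lambda>_. dbar) U \<le> ereal (\<Sum>j<n. c j * x j) +
      (SUP h\<in>U. ereal (\<Sum>j<n. dbar * ((\<Sum>k<m. (\<lambda>_ _. 0) j k * h k) + q j)))"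
    unfolding zAff_def using assms
    by (intro INF_lower2[of "(x, \<lambda>_ _. 0, q)"]) auto
  also have "\<dots> \<le> ereal (\<Sum>j<n. c j * x j) + ereal (dbar * (\<Sum>j<n. q j))"
    by (intro add_left_mono SUP_least) (simp add: sum_distrib_left)
  finally show ?thesis by simp
qed

lemma second_stage_nonneg:
  assumes "\<And>j. j < n \<Longrightarrow> 0 \<le> d j"
  shows "0 \<le> second_stage m n A B d x h"
  unfolding second_stage_def
  by (intro INF_greatest) (use assms in \<open>auto intro!: sum_nonneg mult_nonneg_nonneg\<close>)

lemma zAR_nonneg:
  assumes "\<And>j. j < n \<Longrightarrow> 0 \<le> c j" "\<And>j. j < n \<Longrightarrow> 0 \<le> d j" "U \<noteq> {}"
  shows "0 \<le> zAR m n A B c d U"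
  unfolding zAR_def
proof (rule INF_greatest)
  fix x :: "nat \<Rightarrow> real" assume "x \<in> {x. \<forall>j<n. 0 \<le> x j}"
  then have "0 \<le> (\<Sum>j<n. c j * x j)"
    using assms by (intro sum_nonneg) auto
  moreover have "0 \<le> (SUP h\<in>U. second_stage m n A B d x h)"
  proof -
    obtain h where "h \<in> U" using assms(3) by blast
    then show ?thesis by (rule SUP_upper2) (use assms second_stage_nonneg in auto)
  qed
  ultimately show "0 \<le> ereal (\<Sum>j<n. c j * x j) + (SUP h\<in>U. second_stage m n A B d x h)"
    by (intro add_nonneg_nonneg) auto
qed

text \<open>A strict bound yields a nearly optimal \<open>x\<close> without the infimum being
  attained. A recourse of cost below \<open>z\<close> has total mass below \<open>z / dbar\<close>,
  so it contributes at most \<open>b * (z / dbar)\<close> to a row with entries at most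
  \<open>b\<close>. The bound \<open>b\<close> stays free: it is used both for row maxima and for a
  bound on all entries.\<close>

lemma zAR_lessD:
  assumes c: "\<And>j. j < n \<Longrightarrow> 0 \<le> c j" and d: "0 < dbar" and U: "U \<noteq> {}"
    and less: "zAR m n A B c (\<lambda>_. dbar) U < ereal z"
  obtains x where "\<And>j. j < n \<Longrightarrow> 0 \<le> x j" "(\<Sum>j<n. c j * x j) \<le> z"
    "\<And>h i b. h \<in> U \<Longrightarrow> i < m \<Longrightarrow> (\<And>j. j < n \<Longrightarrow> B i j \<le> b) \<Longrightarrow> 0 \<le> b \<Longrightarrow>
       h i \<le> (\<Sum>j<n. A i j * x j) + b * (z / dbar)"
proof -
  obtain x where x: "\<And>j. j < n \<Longrightarrow> 0 \<le> x j"
    and xz: "ereal (\<Sum>j<n. c j * x j) + (SUP h\<in>U. second_stage m n A B (\<lambda>_. dbar) x h) < ereal z"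
    using less unfolding zAR_def INF_less_iff by auto
  have cx: "0 \<le> (\<Sum>j<n. c j * x j)"
    using c x by (intro sum_nonneg) auto
  have nonneg: "0 \<le> (SUP h\<in>U. second_stage m n A B (\<lambda>_. dbar) x h)"
  proof -
    obtain h where "h \<in> U" using U by blast
    then show ?thesis by (rule SUP_upper2) (use d second_stage_nonneg in auto)
  qed
  have "ereal (\<Sum>j<n. c j * x j) < ereal z"
  proof (rule le_less_trans[OF _ xz])
    show "ereal (\<Sum>j<n. c j * x j)
        \<le> ereal (\<Sum>j<n. c j * x j) + (SUP h\<in>U. second_stage m n A B (\<lambda>_. dbar) x h)"
      using add_left_mono[OF nonneg, of "ereal (\<Sum>j<n. c j * x j)"] by simp
  qed
  moreover have "h i \<le> (\<Sum>j<n. A i j * x j) + b * (z / dbar)"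
    if h: "h \<in> U" and i: "i < m" and b: "\<And>j. j < n \<Longrightarrow> B i j \<le> b" "0 \<le> b" for h i b
  proof -
    have "second_stage m n A B (\<lambda>_. dbar) x h \<le> (SUP h\<in>U. second_stage m n A B (\<lambda>_. dbar) x h)"
      using h by (rule SUP_upper)
    \<comment> \<open>The first-stage cost is nonnegative, so the second-stage value alone is below
      \<open>z\<close>, which provides a recourse \<open>y\<close> for this
      \<open>h\<close>.\<close>
    also have "\<dots> \<le> ereal (\<Sum>j<n. c j * x j) + (SUP h\<in>U. second_stage m n A B (\<lambda>_. dbar) x h)"
    proof -
      have "0 + S \<le> ereal (\<Sum>j<n. c j * x j) + S" for S
        using cx by (intro add_right_mono) simp
      then show ?thesis by simp
    qed
    also have "\<dots> < ereal z" by (fact xz)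
    finally obtain y where y: "\<And>j. j < n \<Longrightarrow> 0 \<le> y j"
        "h i \<le> (\<Sum>j<n. A i j * x j) + (\<Sum>j<n. B i j * y j)" "(\<Sum>j<n. dbar * y j) < z"
      using i unfolding second_stage_def INF_less_iff by auto
    have "(\<Sum>j<n. B i j * y j) \<le> (\<Sum>j<n. b * y j)"
      using b y by (intro sum_mono mult_right_mono) auto
    also have "\<dots> = b * (\<Sum>j<n. y j)" by (simp add: sum_distrib_left)
    also have "\<dots> \<le> b * (z / dbar)"
      using y(3) d b(2) by (intro mult_left_mono) (auto simp: sum_distrib_left[symmetric] field_simps)
    finally show ?thesis using y(2) by linarith
  qed
  ultimately show ?thesis using that[of x] x by auto
qed

text \<open>Let \<open>z\<close> decrease to the adjustable value, with slack
  \<open>e / kappa\<close>. An infinite adjustable value makes the right-hand side infinite since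
  \<open>kappa\<close> is positive.\<close>

lemma zAff_le_scaled_zAR:
  assumes k: "0 < kappa" and nn: "0 \<le> zAR m n A B c d U"
    and le: "\<And>z. zAR m n A B c d U < ereal z \<Longrightarrow> zAff m n A B c d U \<le> ereal (kappa * z)"
  shows "zAff m n A B c d U \<le> ereal kappa * zAR m n A B c d U"
proof (cases "zAR m n A B c d U")
  case (real z0)
  have "zAff m n A B c d U \<le> ereal (kappa * z0) + ereal e" if "0 < e" for e
  proof -
    have "zAff m n A B c d U \<le> ereal (kappa * (z0 + e / kappa))"
      using k that by (intro le) (simp add: real)
    moreover have "kappa * (z0 + e / kappa) = kappa * z0 + e"
      using k by (simp add: distrib_left)
    ultimately show ?thesis by simp
  qed
  then have "zAff m n A B c d U \<le> ereal (kappa * z0)"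
    by (rule ereal_le_epsilon2[rule_format])
  then show ?thesis by (simp add: real)
qed (use k nn in auto)

section \<open>Deficient rows\<close>

text \<open>The left-hand side is the elementary symmetric polynomial of degree \<open>T\<close>.
  After scaling by \<open>1 / s\<close> it is one part of the expansion of the product of all
  \<open>1 + p i / s\<close>, which is at most \<open>exp 1\<close>.\<close>

lemma sum_prod_subsets_le:
  fixes p :: "'a \<Rightarrow> real"
  assumes "finite I" "\<And>i. i \<in> I \<Longrightarrow> 0 \<le> p i" "(\<Sum>i\<in>I. p i) \<le> s" "0 < s"
  shows "(\<Sum>Q | Q \<subseteq> I \<and> card Q = T. \<Prod>i\<in>Q. p i) \<le> exp 1 * s ^ T"
proof -
  have "(1 / s) ^ T * (\<Sum>Q | Q \<subseteq> I \<and> card Q = T. \<Prod>i\<in>Q. p i)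
      = (\<Sum>Q | Q \<subseteq> I \<and> card Q = T. \<Prod>i\<in>Q. p i / s)"
    unfolding sum_distrib_left
    by (intro sum.cong refl) (auto simp: prod_dividef power_one_over)
  also have "\<dots> \<le> (\<Sum>Q\<in>Pow I. \<Prod>i\<in>Q. p i / s)"
    using assms by (intro sum_mono2) (auto intro!: prod_nonneg)
  also have "\<dots> = (\<Prod>i\<in>I. p i / s + 1)"
    using prod_add[OF assms(1), of "\<lambda>i. p i / s" "\<lambda>_. 1"] by simp
  also have "\<dots> \<le> (\<Prod>i\<in>I. exp (p i / s))"
  proof (intro prod_mono conjI)
    fix i assume "i \<in> I"
    then show "0 \<le> p i / s + 1" "p i / s + 1 \<le> exp (p i / s)"
      using assms exp_ge_add_one_self[of "p i / s"] by (auto simp: add.commute)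
  qed
  also have "\<dots> = exp ((\<Sum>i\<in>I. p i) / s)"
    using assms(1) by (simp add: exp_sum sum_divide_distrib)
  also have "\<dots> \<le> exp 1"
    using assms by simp
  finally show ?thesis
    using assms by (simp add: field_simps)
qed

text \<open>\<open>S\<close> is continuous and starts at 0, so it either attains \<open>s\<close>,
  or stays at most \<open>s\<close> at a scale \<open>u1\<close> where no truncated requirement can
  grow further.\<close>

lemma truncated_threshold_exists:
  fixes mu w :: "nat \<Rightarrow> real"
  assumes "\<And>i. i < m \<Longrightarrow> 0 \<le> mu i" "\<And>i. i < m \<Longrightarrow> 0 \<le> w i" "0 < K" "0 < s" "0 < n"
  defines "beta \<equiv> \<lambda>i u. min K (max 0 (mu i * u - w i))"
  defines "S \<equiv> \<lambda>u. \<Sum>i<m. (beta i u / (3 * K)) ^ n"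
  obtains u where "0 \<le> u" "S u \<le> s" "S u = s \<or> (\<forall>i<m. \<forall>v\<ge>0. beta i v \<le> beta i u)"
proof -
  \<comment> \<open>At \<open>u1\<close> every row with \<open>mu i > 0\<close> has reached the cap
    \<open>K\<close>. A row with \<open>mu i = 0\<close> contributes 0 to the sum, division by zero
    being zero, and its truncated requirement does not depend on the scale.\<close>
  define u1 where "u1 = (\<Sum>i<m. (K + w i) / mu i)"
  have "0 \<le> u1"
    unfolding u1_def using assms by (intro sum_nonneg) auto
  have sat: "beta i v \<le> beta i u1" if i: "i < m" and "0 \<le> v" for i v
  proof (cases "mu i = 0")
    case False
    then have "0 < mu i" using assms i by force
    have "(K + w i) / mu i \<le> u1"
      unfolding u1_def using assms i by (intro member_le_sum) auto
    then have "K \<le> mu i * u1 - w i"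
      using \<open>0 < mu i\<close> by (simp add: field_simps)
    then show ?thesis by (simp add: beta_def)
  qed (simp add: beta_def)
  show ?thesis
  proof (cases "S u1 \<le> s")
    case True
    then show ?thesis using that[of u1] sat \<open>0 \<le> u1\<close> by auto
  next
    case False
    \<comment> \<open>Here \<open>0 < n\<close> matters, because \<open>0 ^ 0 = 1\<close>.\<close>
    have "S 0 = 0"
      unfolding S_def using assms by (intro sum.neutral) (auto simp: beta_def power_0_left)
    moreover have "continuous_on {0..u1} S"
      unfolding S_def beta_def using assms by (intro continuous_intros) auto
    ultimately obtain u where "0 \<le> u" "u \<le> u1" "S u = s"
      using IVT'[of S 0 s u1] False \<open>0 \<le> u1\<close> \<open>0 < s\<close> by force
    then show ?thesis using that[of u] by auto
  qed
qed

text \<open>Here \<open>u = 1 / z\<close>, and \<open>mu i * u - w i\<close> is the requirement of row \<open>i\<close> in units of \<open>z / dbar\<close>.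
The bad set does not depend on \<open>u\<close>: at the threshold some row violates the bound by its maximum, so
only scales below the threshold are feasible, and there the requirements are smaller.\<close>

lemma gauss_matrix_few_deficient_rows:
  fixes mu w :: "nat \<Rightarrow> real"
  assumes mn: "0 < m" "3 \<le> n" and reg: "real n \<le> ln (real m)" "ln (real m) \<le> (real n)\<^sup>2"
    and mu: "\<And>i. i < m \<Longrightarrow> 0 \<le> mu i" and w: "\<And>i. i < m \<Longrightarrow> 0 \<le> w i"
    and K: "1 \<le> K" and T: "ln (real m) \<le> real n * real T" "0 < T"
  obtains Bad where "Bad \<in> sets (gauss_matrix m n)"
    "measure (gauss_matrix m n) Bad \<le> 2 / (3 * real m * 2 ^ n)"
    "\<And>G u. G \<in> space (gauss_matrix m n) - Bad \<Longrightarrow> (\<And>i j. i < m \<Longrightarrow> j < n \<Longrightarrow> \<bar>G (i, j)\<bar> \<le> K) \<Longrightarrow>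
       0 \<le> u \<Longrightarrow> (\<And>i. i < m \<Longrightarrow> \<exists>j<n. mu i * u - w i \<le> \<bar>G (i, j)\<bar>) \<Longrightarrow>
       card {i. i < m \<and> 3 * exp 6 * K * (\<Sum>j<n. \<bar>G (i, j)\<bar>) < real n * (mu i * u - w i)} < T"
proof -
  let ?M = "gauss_matrix m n"
  interpret prob_space ?M by (rule prob_space_gauss_matrix)
  \<comment> \<open>Chosen so that \<open>exp (- s)\<close> is at most
    \<open>1 / (3 * m * 2 ^ n)\<close>, which survives a union bound over \<open>2 ^ n\<close>
    candidates.\<close>
  define s where "s = real n + ln (real m) + 2"
  \<comment> \<open>With this constant the Chernoff bound \<open>(exp 1 * (b i / K1)) ^ n\<close>
    for a deficient row is \<open>exp (-5) ^ n\<close> times the lower bound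
    \<open>(b i / (3 * K)) ^ n\<close> for the probability of a small row.\<close>
  define K1 where "K1 = 3 * exp 6 * K"
  have s: "0 < s" using reg mn by (simp add: s_def)
  have K1: "0 < K1" using K by (simp add: K1_def)
  let ?b = "\<lambda>i u. min K (max 0 (mu i * u - w i))"
  obtain u0 where u0: "0 \<le> u0" "(\<Sum>i<m. (?b i u0 / (3 * K)) ^ n) \<le> s"
      "(\<Sum>i<m. (?b i u0 / (3 * K)) ^ n) = s \<or> (\<forall>i<m. \<forall>v\<ge>0. ?b i v \<le> ?b i u0)"
    using truncated_threshold_exists[of m mu w K s n] mu w K s mn by auto
  define b where "b = (\<lambda>i. ?b i u0)"
  have b: "0 \<le> b i" "b i \<le> K" for i
    using K by (auto simp: b_def)
  \<comment> \<open>If the threshold comes from saturation rather than from the value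
    \<open>s\<close>, requirements cannot exceed \<open>b\<close> at any scale and nothing has to be
    excluded.\<close>
  define Bad1 where "Bad1 = (if (\<Sum>i<m. (b i / (3 * K)) ^ n) = s
      then {G \<in> space ?M. \<forall>i<m. \<exists>j<n. b i \<le> \<bar>G (i, j)\<bar>} else {})"
  define BadQ where "BadQ = (\<lambda>Q. {G \<in> space ?M. \<forall>i\<in>Q. (\<Sum>j<n. \<bar>G (i, j)\<bar>) < real n * (b i / K1)})"
  define Qs where "Qs = {Q. Q \<subseteq> {..<m} \<and> card Q = T}"
  have finQs: "finite Qs"
    by (rule finite_subset[of _ "Pow {..<m}"]) (auto simp: Qs_def)
  have "Bad1 \<in> sets ?M"
    unfolding Bad1_def using gauss_matrix_no_small_row_measurable[of m n b] 
    by (simp only: sets.empty_sets simp_thms split: if_split)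
  have BadQ: "BadQ Q \<in> sets ?M" if "Q \<in> Qs" for Q
    unfolding BadQ_def using that
    by (intro gauss_matrix_small_row_sums_measurable) (auto simp: Qs_def)
  have e3: "3 \<le> exp (2::real)"
    using exp_ge_add_one_self[of "2::real"] by simp
  have es: "exp (- s) = 1 / (exp 2 * real m * exp 1 ^ n)"
  proof -
    have "exp s = exp 2 * real m * exp 1 ^ n"
      using mn exp_of_nat_mult[of n "1::real"] by (simp add: s_def exp_add)
    then show ?thesis by (simp only: exp_minus inverse_eq_divide)
  qed
  have "prob Bad1 \<le> exp (- s)"
  proof (cases "(\<Sum>i<m. (b i / (3 * K)) ^ n) = s")
    case True
    have "prob {G \<in> space ?M. \<forall>i<m. \<exists>j<n. b i \<le> \<bar>G (i, j)\<bar>} \<le> exp (- (\<Sum>i<m. (b i / (3 * K)) ^ n))"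
      using b K mn by (intro gauss_matrix_no_small_row) auto
    then show ?thesis unfolding Bad1_def True by simp
  qed (simp add: Bad1_def)
  also have "\<dots> = 1 / (exp 2 * real m * exp 1 ^ n)"
    by (rule es)
  also have "\<dots> \<le> 1 / (3 * real m * 2 ^ n)"
    using mn e3 exp_ge_add_one_self[of "1::real"]
    by (intro divide_left_mono mult_mono power_mono) auto
  finally have p1: "prob Bad1 \<le> 1 / (3 * real m * 2 ^ n)" .
  define sg where "sg = exp (-5) ^ n * s"
  have sg: "0 < sg" using s by (simp add: sg_def)
  have factor: "(exp 1 * (b i / K1)) ^ n = exp (-5) ^ n * (b i / (3 * K)) ^ n" for i
  proof -
    have "exp (6::real) = exp 1 * exp 5" by (simp flip: exp_add)
    then have "exp 1 * (b i / K1) = exp (-5) * (b i / (3 * K))"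
      using K by (simp add: K1_def exp_minus field_simps)
    then show ?thesis by (simp only: power_mult_distrib)
  qed
  have sumle: "(\<Sum>i<m. (exp 1 * (b i / K1)) ^ n) \<le> sg"
    unfolding factor sum_distrib_left[symmetric] sg_def using u0(2)
    by (intro mult_left_mono) (auto simp: b_def)
  \<comment> \<open>Union bound over the sets of \<open>T\<close> rows; the sum of products over
    these sets is an elementary symmetric polynomial in the Chernoff bounds, whose total is at most
    \<open>sg\<close>.\<close>
  have "prob (\<Union>Q\<in>Qs. BadQ Q) \<le> (\<Sum>Q\<in>Qs. prob (BadQ Q))"
    using finQs BadQ by (intro finite_measure_subadditive_finite) auto
  also have "\<dots> \<le> (\<Sum>Q\<in>Qs. \<Prod>i\<in>Q. (exp 1 * (b i / K1)) ^ n)"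
    unfolding BadQ_def using b K1
    by (intro sum_mono gauss_matrix_small_row_sums) (auto simp: Qs_def)
  also have "\<dots> \<le> exp 1 * sg ^ T"
    unfolding Qs_def using sumle sg b K1 by (intro sum_prod_subsets_le) auto
  also have "\<dots> \<le> exp 1 * (exp (- 3 * real n)) ^ T"
  proof -
    have "2 * real n \<le> exp (real n)"
    proof -
      have "1 + real n / 2 \<le> exp (real n / 2)" by (rule exp_ge_add_one_self)
      then have "(1 + real n / 2)\<^sup>2 \<le> (exp (real n / 2))\<^sup>2"
        by (intro power_mono) auto
      moreover have "2 * real n \<le> (1 + real n / 2)\<^sup>2"
        using sum_squares_ge_zero[of "1 - real n / 2" 0] by (simp add: power2_eq_square algebra_simps)
      ultimately show ?thesis by (simp add: exp_double[symmetric])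
    qed
    then have "(2 * real n)\<^sup>2 \<le> (exp (real n))\<^sup>2" by (intro power_mono) auto
    then have "4 * (real n)\<^sup>2 \<le> exp (2 * real n)" by (simp add: exp_double power_mult_distrib)
    \<comment> \<open>The hypothesis \<open>ln m \<le> n\<^sup>2\<close> enters here:
      \<open>s\<close> is at most \<open>exp (2 * n)\<close>, hence \<open>sg\<close> at most
      \<open>exp (- 3 * n)\<close>.\<close>
    moreover have "s \<le> 4 * (real n)\<^sup>2"
    proof -
      have "3 * real n \<le> real n * real n" using mn by (intro mult_right_mono) auto
      then show ?thesis using reg mn unfolding s_def power2_eq_square by linarith
    qed
    ultimately have "s \<le> exp (2 * real n)" by linarith
    then have "sg \<le> exp (-5) ^ n * exp (2 * real n)"
      unfolding sg_def by (intro mult_left_mono) auto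
    also have "\<dots> = exp (- 3 * real n)"
      by (simp add: exp_of_nat_mult[symmetric] exp_add[symmetric])
    finally have "sg \<le> exp (- 3 * real n)" .
    then show ?thesis using sg by (intro mult_left_mono power_mono) auto
  qed
  also have "\<dots> = exp (1 - 3 * (real n * real T))"
    by (simp add: exp_of_nat_mult[symmetric] exp_add[symmetric] mult_ac)
  \<comment> \<open>The three copies of \<open>n * T\<close> pay for \<open>ln m\<close>, for
    \<open>n\<close>, and for the constant 3 in \<open>s + 1\<close>.\<close>
  also have "\<dots> \<le> exp (- s)"
  proof -
    have "real n * 1 \<le> real n * real T" using T(2) by (intro mult_left_mono) auto
    moreover have "3 \<le> real n" using mn by simp
    ultimately have "1 - 3 * (real n * real T) \<le> - s"
      unfolding s_def using T(1) by linarith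
    then show ?thesis by (simp only: exp_le_cancel_iff)
  qed
  also have "\<dots> = 1 / (exp 2 * real m * exp 1 ^ n)"
    by (rule es)
  also have "\<dots> \<le> 1 / (3 * real m * 2 ^ n)"
    using mn e3 exp_ge_add_one_self[of "1::real"]
    by (intro divide_left_mono mult_mono power_mono) auto
  finally have p2: "prob (\<Union>Q\<in>Qs. BadQ Q) \<le> 1 / (3 * real m * 2 ^ n)" .
  show ?thesis
  proof (rule that[of "Bad1 \<union> (\<Union>Q\<in>Qs. BadQ Q)"])
    have U2: "(\<Union>Q\<in>Qs. BadQ Q) \<in> sets ?M"
      using finQs BadQ by (intro sets.finite_UN) auto
    then show "Bad1 \<union> (\<Union>Q\<in>Qs. BadQ Q) \<in> sets ?M"
      using \<open>Bad1 \<in> sets ?M\<close> by auto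
    have "prob (Bad1 \<union> (\<Union>Q\<in>Qs. BadQ Q)) \<le> prob Bad1 + prob (\<Union>Q\<in>Qs. BadQ Q)"
      using \<open>Bad1 \<in> sets ?M\<close> U2 by (rule measure_Un_le)
    then show "prob (Bad1 \<union> (\<Union>Q\<in>Qs. BadQ Q)) \<le> 2 / (3 * real m * 2 ^ n)"
      using p1 p2 by simp
  next
    fix G u
    assume G: "G \<in> space ?M - (Bad1 \<union> (\<Union>Q\<in>Qs. BadQ Q))"
      and GK: "\<And>i j. i < m \<Longrightarrow> j < n \<Longrightarrow> \<bar>G (i, j)\<bar> \<le> K"
      and u: "0 \<le> u" and val: "\<And>i. i < m \<Longrightarrow> \<exists>j<n. mu i * u - w i \<le> \<bar>G (i, j)\<bar>"
    have leK: "mu i * u - w i \<le> K" if "i < m" for i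
      using val[OF that] GK[OF that] by force
    \<comment> \<open>If the threshold value is \<open>s\<close>, then outside \<open>Bad1\<close>
      some row \<open>i0\<close> has all entries below \<open>b i0\<close>. Feasibility of that row
      forces \<open>u\<close> below \<open>u0\<close>, and monotonicity in the scale bounds every
      other row. Otherwise saturation gives the bound directly.\<close>
    have le: "mu i * u - w i \<le> b i" if i: "i < m" for i
    proof (cases "(\<Sum>i<m. (b i / (3 * K)) ^ n) = s")
      case True
      then obtain i0 where i0: "i0 < m" "\<And>j. j < n \<Longrightarrow> \<bar>G (i0, j)\<bar> < b i0"
        using G by (auto simp: Bad1_def not_le)
      obtain j where j: "j < n" "mu i0 * u - w i0 \<le> \<bar>G (i0, j)\<bar>" using val i0 by blast
      have lt: "\<bar>G (i0, j)\<bar> < b i0" using i0 j by blast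
      then have "0 < b i0" by linarith
      then have "b i0 \<le> mu i0 * u0 - w i0" by (auto simp: b_def)
      then have "mu i0 * u < mu i0 * u0" using j lt by linarith
      then have "u \<le> u0" using mu[OF i0(1)] by (metis mult_left_mono not_le less_imp_le)
      then have "mu i * u \<le> mu i * u0" using mu[OF i] by (intro mult_left_mono)
      then show ?thesis using leK[OF i] by (auto simp: b_def)
    next
      case False
      then have "?b i u \<le> b i" using u0(3) u i by (auto simp: b_def)
      then show ?thesis using leK[OF i] by linarith
    qed
    let ?D = "{i. i < m \<and> 3 * exp 6 * K * (\<Sum>j<n. \<bar>G (i, j)\<bar>) < real n * (mu i * u - w i)}"
    show "card ?D < T"
    proof (rule ccontr)
      assume "\<not> card ?D < T"
      then have "T \<le> card ?D" by (simp only: not_less)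
      then obtain Q where Q: "Q \<subseteq> ?D" "card Q = T"
        by (rule obtain_subset_with_card_n)
      then have "Q \<in> Qs" by (auto simp: Qs_def)
      moreover have "(\<Sum>j<n. \<bar>G (i, j)\<bar>) < real n * (b i / K1)" if "i \<in> Q" for i
      proof -
        have "K1 * (\<Sum>j<n. \<bar>G (i, j)\<bar>) < real n * (mu i * u - w i)" "i < m"
          using that Q by (auto simp: K1_def)
        moreover have "real n * (mu i * u - w i) \<le> real n * b i"
          using le \<open>i < m\<close> by (intro mult_left_mono) auto
        ultimately show ?thesis using K1 by (simp add: field_simps)
      qed
      ultimately have "G \<in> (\<Union>Q\<in>Qs. BadQ Q)"
        using G by (auto simp: BadQ_def)
      then show False using G by blast
    qed
  qed
qed

text \<open>Rows that can be covered by a first-stage variable of cost zero get requirement \<open>mu i = 0\<close>.\<close>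

lemma static_policy_from_candidate:
  fixes A :: "nat \<Rightarrow> nat \<Rightarrow> real" and G :: "nat \<times> nat \<Rightarrow> real"
  assumes n: "0 < n" and d: "0 < dbar" and z: "0 < z"
    and A: "\<And>i j. i < m \<Longrightarrow> j < n \<Longrightarrow> 0 \<le> A i j" and v: "\<And>j. j < n \<Longrightarrow> 0 \<le> v j"
    and M: "\<And>h i. h \<in> U \<Longrightarrow> i < m \<Longrightarrow> h i \<le> M i" and M0: "\<And>i. i < m \<Longrightarrow> 0 \<le> M i"
    and mu: "\<And>i. mu i = (if \<exists>j<n. c j = 0 \<and> 0 < A i j then 0 else dbar * M i)"
    and w: "\<And>i. w i = dbar * (\<Sum>j<n. A i j * v j)"
    and K: "0 \<le> K"
    and val: "\<And>i. i < m \<Longrightarrow> \<exists>j<n. mu i * (1 / z) - w i \<le> \<bar>G (i, j)\<bar>"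
    and few: "card {i. i < m \<and> K * (\<Sum>j<n. \<bar>G (i, j)\<bar>) < real n * (mu i * (1 / z) - w i)} \<le> T"
  shows "zAff m n A (\<lambda>i j. \<bar>G (i, j)\<bar>) c (\<lambda>_. dbar) U
    \<le> ereal ((\<Sum>j<n. c j * v j) * z + (K + real T) * z)"
proof -
  define Q where "Q = {i. i < m \<and> K * (\<Sum>j<n. \<bar>G (i, j)\<bar>) < real n * (mu i * (1 / z) - w i)}"
  have finQ: "finite Q" by (simp add: Q_def)
  obtain J where J: "\<And>i. i < m \<Longrightarrow> J i < n \<and> mu i * (1 / z) - w i \<le> \<bar>G (i, J i)\<bar>"
    using val by metis
  \<comment> \<open>Summands with \<open>A i j = 0\<close> are zero, as division by zero yields zero.\<close>
  define x where "x = (\<lambda>j. if c j = 0 then (\<Sum>i<m. M i / A i j) + z * v j else z * v j)"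
  \<comment> \<open>The constant part serves each row whose average is large enough; in addition
    every deficient row \<open>i\<close> receives \<open>z / dbar\<close> in a column
    \<open>J i\<close> whose entry alone meets its requirement.\<close>
  define q where "q = (\<lambda>j. z * K / (real n * dbar) + (\<Sum>i\<in>Q. if J i = j then z / dbar else 0))"
  have sumMA: "0 \<le> (\<Sum>i<m. M i / A i j)" if "j < n" for j
    using A M0 that by (intro sum_nonneg) auto
  have x0: "0 \<le> x j" if "j < n" for j
    using sumMA[OF that] v[OF that] z by (auto simp: x_def)
  have sumQ: "0 \<le> (\<Sum>i\<in>Q. if J i = j then z / dbar else 0)" for j
    using z d by (intro sum_nonneg) auto
  have qK: "z * K / (real n * dbar) \<le> q j" for j
    using sumQ by (simp add: q_def)
  have q0: "0 \<le> q j" for j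
    using qK[of j] z d K by (meson divide_nonneg_nonneg mult_nonneg_nonneg less_imp_le of_nat_0_le_iff order_trans)
  have qJ: "z / dbar \<le> q (J i)" if "i \<in> Q" for i
  proof -
    have "(if J i = J i then z / dbar else 0) \<le> (\<Sum>i'\<in>Q. if J i' = J i then z / dbar else 0)"
      using finQ z d that by (intro member_le_sum) auto
    moreover have "0 \<le> z * K / (real n * dbar)" using z d K by simp
    ultimately show ?thesis by (simp add: q_def)
  qed
  have cover: "h i \<le> (\<Sum>j<n. A i j * x j) + (\<Sum>j<n. \<bar>G (i, j)\<bar> * q j)" if h: "h \<in> U" and i: "i < m" for h i
  proof (cases "\<exists>j<n. c j = 0 \<and> 0 < A i j")
    \<comment> \<open>The sum added to the free variable \<open>x j\<close> contains
      \<open>M i / A i j\<close>, which covers row \<open>i\<close> at no cost.\<close>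
    case True
    then obtain j where j: "j < n" "c j = 0" "0 < A i j" by blast
    have "M i / A i j \<le> (\<Sum>i<m. M i / A i j)"
      using A M0 i j by (intro member_le_sum) auto
    also have "\<dots> \<le> x j" using j v z by (simp add: x_def)
    finally have "M i \<le> A i j * x j" using j by (simp add: field_simps)
    also have "\<dots> \<le> (\<Sum>j<n. A i j * x j)"
      using A i x0 j by (intro member_le_sum) auto
    finally have "M i \<le> (\<Sum>j<n. A i j * x j)" .
    moreover have "0 \<le> (\<Sum>j<n. \<bar>G (i, j)\<bar> * q j)" using q0 by (intro sum_nonneg) auto
    ultimately show ?thesis using M[OF h i] by linarith
  next
    case False
    have Ax: "(\<Sum>j<n. A i j * x j) = z * (\<Sum>j<n. A i j * v j)"
      unfolding sum_distrib_left
    proof (intro sum.cong refl)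
      fix j assume "j \<in> {..<n}"
      then have "c j = 0 \<Longrightarrow> A i j = 0" using False A[OF i] by force
      then show "A i j * x j = z * (A i j * v j)" by (auto simp: x_def)
    qed
    \<comment> \<open>The requirement in units of \<open>z / dbar\<close> is what the scaled
      candidate \<open>z * v\<close> leaves uncovered of the worst case \<open>M i\<close>.\<close>
    have need: "M i = z * (\<Sum>j<n. A i j * v j) + (z / dbar) * (mu i * (1 / z) - w i)"
    proof -
      have "mu i = dbar * M i" using mu[of i] False by auto
      then show ?thesis using d z by (simp add: w field_simps)
    qed
    have "(z / dbar) * (mu i * (1 / z) - w i) \<le> (\<Sum>j<n. \<bar>G (i, j)\<bar> * q j)"
    proof (cases "i \<in> Q")
      case True
      have "(z / dbar) * (mu i * (1 / z) - w i) \<le> (z / dbar) * \<bar>G (i, J i)\<bar>"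
        using J[OF i] z d by (intro mult_left_mono) auto
      also have "\<dots> \<le> q (J i) * \<bar>G (i, J i)\<bar>"
        using qJ[OF True] by (intro mult_right_mono) auto
      also have "\<dots> = \<bar>G (i, J i)\<bar> * q (J i)" by simp
      also have "\<dots> \<le> (\<Sum>j<n. \<bar>G (i, j)\<bar> * q j)"
        using J[OF i] q0 by (intro member_le_sum) auto
      finally show ?thesis .
    next
      case nQ: False
      then have "real n * (mu i * (1 / z) - w i) \<le> K * (\<Sum>j<n. \<bar>G (i, j)\<bar>)"
        using i by (auto simp: Q_def)
      then have "(z / (real n * dbar)) * (real n * (mu i * (1 / z) - w i))
          \<le> (z / (real n * dbar)) * (K * (\<Sum>j<n. \<bar>G (i, j)\<bar>))"
        using z d by (intro mult_left_mono) auto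
      then have "(z / dbar) * (mu i * (1 / z) - w i) \<le> (\<Sum>j<n. \<bar>G (i, j)\<bar> * (z * K / (real n * dbar)))"
        using n by (subst sum_distrib_right[symmetric]) (simp add: mult_ac)
      also have "\<dots> \<le> (\<Sum>j<n. \<bar>G (i, j)\<bar> * q j)"
        by (intro sum_mono mult_left_mono qK) auto
      finally show ?thesis .
    qed
    then show ?thesis using need M[OF h i] Ax by linarith
  qed
  have "(\<Sum>j<n. q j) = z * K / dbar + (\<Sum>j<n. \<Sum>i\<in>Q. if J i = j then z / dbar else 0)"
    using n by (simp add: q_def sum.distrib)
  also have "(\<Sum>j<n. \<Sum>i\<in>Q. if J i = j then z / dbar else 0) = (\<Sum>i\<in>Q. \<Sum>j<n. if J i = j then z / dbar else 0)"
    by (rule sum.swap)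
  \<comment> \<open>Each deficient row contributes to exactly one column, so it costs
    \<open>z\<close> in total.\<close>
  also have "\<dots> = (\<Sum>i\<in>Q. z / dbar)"
    using J by (intro sum.cong refl) (auto simp: Q_def)
  finally have "(\<Sum>j<n. q j) = z * K / dbar + real (card Q) * (z / dbar)" by simp
  then have "dbar * (\<Sum>j<n. q j) = (K + real (card Q)) * z"
    using d by (simp add: field_simps)
  also have "\<dots> \<le> (K + real T) * z"
    using few z by (intro mult_right_mono) (auto simp: Q_def)
  finally have cost: "dbar * (\<Sum>j<n. q j) \<le> (K + real T) * z" .
  have "(\<Sum>j<n. c j * x j) = (\<Sum>j<n. c j * v j) * z"
    unfolding sum_distrib_right by (intro sum.cong refl) (auto simp: x_def)
  moreover have "zAff m n A (\<lambda>i j. \<bar>G (i, j)\<bar>) c (\<lambda>_. dbar) U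
      \<le> ereal ((\<Sum>j<n. c j * x j) + dbar * (\<Sum>j<n. q j))"
    using x0 q0 cover by (intro zAff_le_static) auto
  ultimately show ?thesis
    using cost by (auto elim!: order_trans)
qed

text \<open>\<open>D\<close> collects the coordinates whose cost exceeds \<open>t * z / n\<close>;
  there are at most \<open>n / t \<le> t\<close> of them, and each is raised to cost
  \<open>z\<close>. The others are raised to cost \<open>t * z / n\<close>, together at most
  \<open>t * z\<close>. The rounded vector depends on \<open>x\<close> only through
  \<open>D\<close>, apart from the factor \<open>z\<close>.\<close>

lemma rounding_of_first_stage:
  fixes c x :: "nat \<Rightarrow> real"
  assumes n: "0 < n" and z: "0 < z" and t: "0 < t" "real n \<le> t\<^sup>2"
    and c: "\<And>j. j < n \<Longrightarrow> 0 \<le> c j" and x: "\<And>j. j < n \<Longrightarrow> 0 \<le> x j"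
    and cx: "(\<Sum>j<n. c j * x j) \<le> z"
  defines "v \<equiv> \<lambda>D j. if c j = 0 then 0 else if j \<in> D then 1 / c j else t / (real n * c j)"
  obtains D where "D \<subseteq> {..<n}" "\<And>j. j < n \<Longrightarrow> c j \<noteq> 0 \<Longrightarrow> x j \<le> z * v D j"
    "(\<Sum>j<n. c j * v D j) \<le> 2 * t"
proof -
  define D where "D = {j. j < n \<and> t * z / real n < c j * x j}"
  have D: "D \<subseteq> {..<n}" by (auto simp: D_def)
  then have finD: "finite D" using finite_subset by blast
  have "x j \<le> z * v D j" if j: "j < n" "c j \<noteq> 0" for j
  proof (cases "j \<in> D")
    case True
    have "c j * x j \<le> (\<Sum>j<n. c j * x j)"
      using c x j by (intro member_le_sum) auto
    then have "c j * x j \<le> z" using cx by linarith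
    then show ?thesis using True j c[OF j(1)] by (simp add: v_def field_simps)
  next
    case False
    then have "c j * x j \<le> t * z / real n" using j by (auto simp: D_def)
    then show ?thesis using False j c[OF j(1)] n by (simp add: v_def field_simps)
  qed
  moreover have "(\<Sum>j<n. c j * v D j) \<le> 2 * t"
  proof -
    have "real (card D) * (t * z / real n) = (\<Sum>j\<in>D. t * z / real n)" by simp
    also have "\<dots> \<le> (\<Sum>j\<in>D. c j * x j)"
      by (intro sum_mono) (auto simp: D_def)
    also have "\<dots> \<le> (\<Sum>j<n. c j * x j)"
      using D c x by (intro sum_mono2) auto
    finally have "real (card D) * (t * z / real n) \<le> z" using cx by linarith
    then have "real (card D) * t \<le> real n"
      using z n by (simp add: field_simps)
    then have "real (card D) * t \<le> t * t" using t(2) by (simp add: power2_eq_square)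
    then have cD: "real (card D) \<le> t" using t(1) by simp
    have "(\<Sum>j<n. c j * v D j) \<le> (\<Sum>j<n. (if j \<in> D then 1 else 0) + t / real n)"
      using t n by (intro sum_mono) (auto simp: v_def)
    also have "\<dots> = real (card D) + t"
      using n D by (simp add: sum.distrib sum.If_cases Int_absorb1)
    finally show ?thesis using cD by linarith
  qed
  ultimately show ?thesis using that[of D] D by blast
qed

section \<open>The approximation factor\<close>

lemma event_of_bad_sets:
  assumes "prob_space M" "X \<in> sets M" "Y \<in> sets M"
    and "measure M X \<le> a" "measure M Y \<le> b" "a + b \<le> e"
  shows "space M - (X \<union> Y) \<in> sets M" "1 - e \<le> measure M (space M - (X \<union> Y))"
proof -
  interpret prob_space M by fact
  have "prob (X \<union> Y) \<le> prob X + prob Y"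
    using assms(2,3) by (rule measure_Un_le)
  moreover have "prob (space M - (X \<union> Y)) = 1 - prob (X \<union> Y)"
    using assms by (intro prob_compl) auto
  ultimately show "1 - e \<le> prob (space M - (X \<union> Y))" using assms by linarith
qed (use assms in auto)

text \<open>Large entries thus use a third of the failure probability \<open>1 / m\<close>.\<close>

lemma entries_bound_le:
  fixes m n :: nat
  assumes "1 \<le> m" "3 \<le> n"
  shows "sqrt 2 / (real m * real n)\<^sup>2 \<le> 1 / (3 * real m)"
proof -
  have "sqrt 2 \<le> 2" by (intro real_le_lsqrt) auto
  moreover have "9 \<le> (real n)\<^sup>2" using assms power_mono[of 3 "real n" 2] by simp
  then have "1 * 9 \<le> real m * (real n)\<^sup>2" using assms by (intro mult_mono) auto
  ultimately have "3 * sqrt 2 \<le> real m * (real n)\<^sup>2" by linarith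
  then show ?thesis
    using assms by (simp add: field_simps power2_eq_square)
qed

lemma abs_entry_attaining_max:
  fixes G :: "nat \<times> nat \<Rightarrow> real"
  assumes "0 < n"
  obtains k where "k < n" "\<And>j. j < n \<Longrightarrow> \<bar>G (i, j)\<bar> \<le> \<bar>G (i, k)\<bar>"
proof -
  have "Max ((\<lambda>j. \<bar>G (i, j)\<bar>) ` {..<n}) \<in> (\<lambda>j. \<bar>G (i, j)\<bar>) ` {..<n}"
    using assms by (intro Max_in) auto
  then obtain k where "k < n" "\<bar>G (i, k)\<bar> = Max ((\<lambda>j. \<bar>G (i, j)\<bar>) ` {..<n})" by auto
  then show ?thesis using that[of k] by simp
qed

section \<open>Bounds in the three regimes of \<open>ln m\<close> against \<open>n\<close>\<close>

text \<open>The static vector with all entries \<open>z / dbar\<close> includes the column of the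
  largest entry in every row; this holds for every matrix, without probability.\<close>

lemma zAff_bound_few_columns:
  assumes n: "0 < n" and c: "\<And>j. j < n \<Longrightarrow> 0 \<le> c j" and d: "0 < dbar" and U: "U \<noteq> {}"
    and less: "zAR m n A (\<lambda>i j. \<bar>G (i, j)\<bar>) c (\<lambda>_. dbar) U < ereal z"
  shows "zAff m n A (\<lambda>i j. \<bar>G (i, j)\<bar>) c (\<lambda>_. dbar) U \<le> ereal ((1 + real n) * z)"
proof -
  obtain x where x: "\<And>j. j < n \<Longrightarrow> 0 \<le> x j" "(\<Sum>j<n. c j * x j) \<le> z"
    "\<And>h i b. h \<in> U \<Longrightarrow> i < m \<Longrightarrow> (\<And>j. j < n \<Longrightarrow> \<bar>G (i, j)\<bar> \<le> b) \<Longrightarrow> 0 \<le> b \<Longrightarrow>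
       h i \<le> (\<Sum>j<n. A i j * x j) + b * (z / dbar)"
    using zAR_lessD[OF c d U less] by blast
  have z: "0 \<le> z"
    using x(2) sum_nonneg[of "{..<n}" "\<lambda>j. c j * x j"] c x(1) by force
  have "zAff m n A (\<lambda>i j. \<bar>G (i, j)\<bar>) c (\<lambda>_. dbar) U
      \<le> ereal ((\<Sum>j<n. c j * x j) + dbar * (\<Sum>j<n. z / dbar))"
  proof (rule zAff_le_static)
    fix h i assume hi: "h \<in> U" "i < m"
    obtain k where k: "k < n" "\<And>j. j < n \<Longrightarrow> \<bar>G (i, j)\<bar> \<le> \<bar>G (i, k)\<bar>"
      using abs_entry_attaining_max[OF n] by blast
    have "h i \<le> (\<Sum>j<n. A i j * x j) + \<bar>G (i, k)\<bar> * (z / dbar)"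
      using hi k by (intro x(3)) auto
    also have "\<bar>G (i, k)\<bar> * (z / dbar) \<le> (\<Sum>j<n. \<bar>G (i, j)\<bar> * (z / dbar))"
      using k z d by (intro member_le_sum) auto
    finally show "h i \<le> (\<Sum>j<n. A i j * x j) + (\<Sum>j<n. \<bar>G (i, j)\<bar> * (z / dbar))" by simp
  qed (use x z d in auto)
  also have "(\<Sum>j<n. c j * x j) + dbar * (\<Sum>j<n. z / dbar) \<le> (1 + real n) * z"
    using x(2) d by (simp add: algebra_simps)
  finally show ?thesis by simp
qed

text \<open>The constant static vector is scaled so that a row sum of at least \<open>n * e\<close>
  produces at least \<open>K * (z / dbar)\<close>, the most that any recourse of cost
  \<open>z\<close> can contribute to a row.\<close>

lemma zAff_bound_balanced_rows:
  assumes n: "0 < n" and c: "\<And>j. j < n \<Longrightarrow> 0 \<le> c j" and d: "0 < dbar" and U: "U \<noteq> {}"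
    and K: "0 \<le> K" and e: "0 < e"
    and up: "\<And>i j. i < m \<Longrightarrow> j < n \<Longrightarrow> \<bar>G (i, j)\<bar> \<le> K"
    and low: "\<And>i. i < m \<Longrightarrow> real n * e \<le> (\<Sum>j<n. \<bar>G (i, j)\<bar>)"
    and less: "zAR m n A (\<lambda>i j. \<bar>G (i, j)\<bar>) c (\<lambda>_. dbar) U < ereal z"
  shows "zAff m n A (\<lambda>i j. \<bar>G (i, j)\<bar>) c (\<lambda>_. dbar) U \<le> ereal ((1 + K / e) * z)"
proof -
  obtain x where x: "\<And>j. j < n \<Longrightarrow> 0 \<le> x j" "(\<Sum>j<n. c j * x j) \<le> z"
    "\<And>h i b. h \<in> U \<Longrightarrow> i < m \<Longrightarrow> (\<And>j. j < n \<Longrightarrow> \<bar>G (i, j)\<bar> \<le> b) \<Longrightarrow> 0 \<le> b \<Longrightarrow>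
       h i \<le> (\<Sum>j<n. A i j * x j) + b * (z / dbar)"
    using zAR_lessD[OF c d U less] by blast
  have z: "0 \<le> z"
    using x(2) sum_nonneg[of "{..<n}" "\<lambda>j. c j * x j"] c x(1) by force
  let ?q = "K / (real n * e) * (z / dbar)"
  have q: "0 \<le> ?q" using K e z d by simp
  have "zAff m n A (\<lambda>i j. \<bar>G (i, j)\<bar>) c (\<lambda>_. dbar) U
      \<le> ereal ((\<Sum>j<n. c j * x j) + dbar * (\<Sum>j<n. ?q))"
  proof (rule zAff_le_static)
    fix h i assume hi: "h \<in> U" "i < m"
    have "h i \<le> (\<Sum>j<n. A i j * x j) + K * (z / dbar)"
      using hi up K by (intro x(3)) auto
    also have "K * (z / dbar) = (real n * e) * ?q" using n e by simp
    also have "\<dots> \<le> (\<Sum>j<n. \<bar>G (i, j)\<bar>) * ?q"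
      using low[OF hi(2)] q by (rule mult_right_mono)
    also have "\<dots> = (\<Sum>j<n. \<bar>G (i, j)\<bar> * ?q)" by (rule sum_distrib_right)
    finally show "h i \<le> (\<Sum>j<n. A i j * x j) + (\<Sum>j<n. \<bar>G (i, j)\<bar> * ?q)" by simp
  qed (use x q in auto)
  also have "(\<Sum>j<n. c j * x j) + dbar * (\<Sum>j<n. ?q) \<le> (1 + K / e) * z"
    using x(2) d n e by (simp add: field_simps)
  finally show ?thesis by simp
qed

text \<open>With threshold \<open>exp (-4)\<close> the Chernoff bound for a single row is
  \<open>exp (- 3 * n)\<close>, small enough for a union bound over the rows when
  \<open>ln m \<le> n\<close>.\<close>

lemma affine_bound_many_columns:
  assumes mn: "1 \<le> m" "3 \<le> n" and reg: "ln (real m) \<le> real n"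
    and c: "\<And>j. j < n \<Longrightarrow> 0 \<le> c j" and d: "0 < dbar" and U: "U \<noteq> {}"
  defines "K \<equiv> sqrt (12 * (ln (real m) + ln (real n)))"
  obtains E where "E \<in> sets (gauss_matrix m n)" "1 - 1 / real m \<le> measure (gauss_matrix m n) E"
    "\<And>G z. G \<in> E \<Longrightarrow> zAR m n A (\<lambda>i j. \<bar>G (i, j)\<bar>) c (\<lambda>_. dbar) U < ereal z \<Longrightarrow>
       zAff m n A (\<lambda>i j. \<bar>G (i, j)\<bar>) c (\<lambda>_. dbar) U \<le> ereal ((1 + K / exp (-4)) * z)"
proof -
  let ?M = "gauss_matrix m n"
  interpret prob_space ?M by (rule prob_space_gauss_matrix)
  define X where "X = {G \<in> space ?M. \<exists>i<m. \<exists>j<n. K < \<bar>G (i, j)\<bar>}"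
  define R where "R = (\<lambda>k::nat. {G \<in> space ?M. \<forall>i\<in>{k}. (\<Sum>j<n. \<bar>G (i, j)\<bar>) < real n * exp (-4)})"
  define Y where "Y = (\<Union>k<m. R k)"
  have X: "X \<in> sets ?M" "prob X \<le> sqrt 2 / (real m * real n)\<^sup>2"
  proof -
    have "0 < m" "0 < n" using mn by auto
    note bounded = gauss_matrix_entries_bounded[OF this meta_eq_to_obj_eq[OF K_def]]
    show "X \<in> sets ?M" "prob X \<le> sqrt 2 / (real m * real n)\<^sup>2"
      unfolding X_def by (fact bounded)+
  qed
  have R: "R k \<in> sets ?M" "prob (R k) \<le> exp (- 3 * real n)" if "k < m" for k
  proof -
    show "R k \<in> sets ?M" unfolding R_def using that
      by (intro gauss_matrix_small_row_sums_measurable) auto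
    have "prob (R k) \<le> (\<Prod>i\<in>{k}. (exp 1 * exp (-4)) ^ n)"
      unfolding R_def using that by (intro gauss_matrix_small_row_sums) auto
    also have "\<dots> = exp (- 3 * real n)"
      by (simp add: exp_add[symmetric] exp_of_nat_mult[symmetric] mult.commute)
    finally show "prob (R k) \<le> exp (- 3 * real n)" .
  qed
  have Y: "Y \<in> sets ?M"
    unfolding Y_def using R by (intro sets.finite_UN) auto
  have "prob Y \<le> (\<Sum>k<m. prob (R k))"
    unfolding Y_def using R by (intro finite_measure_subadditive_finite) auto
  also have "\<dots> \<le> (\<Sum>k<m. exp (- 3 * real n))"
    using R by (intro sum_mono) auto
  also have "\<dots> = real m * exp (- 3 * real n)" by simp
  \<comment> \<open>Two of the three copies of \<open>n\<close> absorb \<open>2 * ln m\<close>, the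
    third absorbs the constant 2.\<close>
  also have "\<dots> \<le> real m * exp (- (2 * ln (real m) + 2))"
    using reg mn by (intro mult_left_mono) auto
  also have "\<dots> = 1 / (exp 2 * real m)"
  proof -
    have "exp (2 * ln (real m) + 2) = real m * real m * exp 2"
      using mn by (simp add: exp_add exp_double power2_eq_square)
    then show ?thesis using mn by (simp only: exp_minus inverse_eq_divide) simp
  qed
  also have "\<dots> \<le> 1 / (3 * real m)"
    using mn exp_ge_add_one_self[of "2::real"] by (intro divide_left_mono mult_right_mono) auto
  finally have pY: "prob Y \<le> 1 / (3 * real m)" .
  have sum: "sqrt 2 / (real m * real n)\<^sup>2 + 1 / (3 * real m) \<le> 1 / real m"
  proof -
    have "1 / (3 * real m) = 1 / real m / 3" "0 \<le> 1 / real m" by auto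
    then show ?thesis using entries_bound_le[OF mn] by linarith
  qed
  note E = event_of_bad_sets[OF prob_space_axioms X(1) Y X(2) pY sum]
  show ?thesis
  proof (rule that[OF E])
    fix G z assume G: "G \<in> space ?M - (X \<union> Y)"
      and less: "zAR m n A (\<lambda>i j. \<bar>G (i, j)\<bar>) c (\<lambda>_. dbar) U < ereal z"
    show "zAff m n A (\<lambda>i j. \<bar>G (i, j)\<bar>) c (\<lambda>_. dbar) U \<le> ereal ((1 + K / exp (-4)) * z)"
    proof (rule zAff_bound_balanced_rows[OF _ c d U _ _ _ _ less])
      show "0 \<le> K" using mn by (simp add: K_def)
      show "\<bar>G (i, j)\<bar> \<le> K" if "i < m" "j < n" for i j
        using G that by (force simp: X_def)
      show "real n * exp (-4) \<le> (\<Sum>j<n. \<bar>G (i, j)\<bar>)" if "i < m" for i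
        using G that by (force simp: Y_def R_def)
    qed (use mn in auto)
  qed
qed

text \<open>The three summands of the factor pay for the rounded first stage, the constant part of
  the static policy and the deficient rows. The bad events for all \<open>D\<close> together have
  probability at most \<open>2 / (3 * m)\<close>.\<close>

lemma affine_bound_intermediate:
  assumes mn: "1 \<le> m" "3 \<le> n" and reg: "real n \<le> ln (real m)" "ln (real m) \<le> (real n)\<^sup>2"
    and A: "\<And>i j. i < m \<Longrightarrow> j < n \<Longrightarrow> 0 \<le> A i j"
    and c: "\<And>j. j < n \<Longrightarrow> 0 \<le> c j" and d: "0 < dbar" and U: "U \<noteq> {}"
    and bdd: "\<And>i. i < m \<Longrightarrow> bdd_above ((\<lambda>h. h i) ` U)"
    and U0: "\<forall>h\<in>U. \<forall>i<m. 0 \<le> h i"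
    and T: "ln (real m) \<le> real n * real T" "0 < T"
  defines "K \<equiv> sqrt (12 * (ln (real m) + ln (real n)))"
  obtains E where "E \<in> sets (gauss_matrix m n)" "1 - 1 / real m \<le> measure (gauss_matrix m n) E"
    "\<And>G z. G \<in> E \<Longrightarrow> zAR m n A (\<lambda>i j. \<bar>G (i, j)\<bar>) c (\<lambda>_. dbar) U < ereal z \<Longrightarrow>
       zAff m n A (\<lambda>i j. \<bar>G (i, j)\<bar>) c (\<lambda>_. dbar) U
         \<le> ereal ((2 * sqrt (ln (real m)) + 3 * exp 6 * K + real T) * z)"
proof -
  let ?M = "gauss_matrix m n"
  interpret prob_space ?M by (rule prob_space_gauss_matrix)
  \<comment> \<open>This choice makes the rounding condition \<open>n \<le> t\<^sup>2\<close> the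
    regime hypothesis.\<close>
  define t where "t = sqrt (ln (real m))"
  have lnm: "3 \<le> ln (real m)" using reg mn by simp
  have t: "0 < t" "real n \<le> t\<^sup>2" using lnm reg by (auto simp: t_def)
  have K: "1 \<le> K"
  proof -
    have "0 \<le> ln (real n)" using mn by simp
    then have "1\<^sup>2 \<le> 12 * (ln (real m) + ln (real n))" using lnm by simp
    then show ?thesis unfolding K_def by (rule real_le_rsqrt)
  qed
  define M where "M = (\<lambda>i. SUP h\<in>U. h i)"
  have M: "h i \<le> M i" if "h \<in> U" "i < m" for h i
    unfolding M_def using bdd that by (intro cSUP_upper)
  have M0: "0 \<le> M i" if "i < m" for i
  proof -
    obtain h where "h \<in> U" using U by blast
    then show ?thesis using M[of h i] U0 that by force
  qed
  define v where "v = (\<lambda>D j. if c j = 0 then 0 else if j \<in> D then 1 / c j else t / (real n * c j))"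
  have v: "0 \<le> v D j" if "j < n" for D j
    using c[OF that] t by (auto simp: v_def)
  define mu where "mu = (\<lambda>i. if \<exists>j<n. c j = 0 \<and> 0 < A i j then 0 else dbar * M i)"
  define w where "w = (\<lambda>D i. dbar * (\<Sum>j<n. A i j * v D j))"
  have mu0: "0 \<le> mu i" if "i < m" for i using M0[OF that] d by (auto simp: mu_def)
  have w0: "0 \<le> w D i" if "i < m" for D i
    unfolding w_def using A v d that by (intro mult_nonneg_nonneg sum_nonneg) auto
  define good where "good = (\<lambda>D Bad. Bad \<in> sets ?M \<and> prob Bad \<le> 2 / (3 * real m * 2 ^ n) \<and>
    (\<forall>G u. G \<in> space ?M - Bad \<longrightarrow> (\<forall>i j. i < m \<longrightarrow> j < n \<longrightarrow> \<bar>G (i, j)\<bar> \<le> K) \<longrightarrow>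
       0 \<le> u \<longrightarrow> (\<forall>i<m. \<exists>j<n. mu i * u - w D i \<le> \<bar>G (i, j)\<bar>) \<longrightarrow>
       card {i. i < m \<and> 3 * exp 6 * K * (\<Sum>j<n. \<bar>G (i, j)\<bar>) < real n * (mu i * u - w D i)} < T))"
  have "\<exists>Bad. good D Bad" for D
  proof -
    have "0 < m" using mn by simp
    obtain Bad where "Bad \<in> sets ?M" "prob Bad \<le> 2 / (3 * real m * 2 ^ n)"
      "\<And>G u. G \<in> space ?M - Bad \<Longrightarrow> (\<And>i j. i < m \<Longrightarrow> j < n \<Longrightarrow> \<bar>G (i, j)\<bar> \<le> K) \<Longrightarrow>
       0 \<le> u \<Longrightarrow> (\<And>i. i < m \<Longrightarrow> \<exists>j<n. mu i * u - w D i \<le> \<bar>G (i, j)\<bar>) \<Longrightarrow>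
       card {i. i < m \<and> 3 * exp 6 * K * (\<Sum>j<n. \<bar>G (i, j)\<bar>) < real n * (mu i * u - w D i)} < T"
      using gauss_matrix_few_deficient_rows[of m n mu "w D" K T, OF \<open>0 < m\<close> mn(2) reg mu0 w0 K T] by blast
    then have "good D Bad" unfolding good_def by blast
    then show ?thesis by blast
  qed
  \<comment> \<open>One bad set per candidate, fixed before the matrix and the scale
    \<open>z\<close> are known.\<close>
  then obtain Bad where good: "\<And>D. good D (Bad D)"
    using choice[of good] by blast
  have Bad: "Bad D \<in> sets ?M" "prob (Bad D) \<le> 2 / (3 * real m * 2 ^ n)" for D
    using good[of D] unfolding good_def by blast+
  define X where "X = {G \<in> space ?M. \<exists>i<m. \<exists>j<n. K < \<bar>G (i, j)\<bar>}"
  define Y where "Y = (\<Union>D\<in>Pow {..<n}. Bad D)"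
  have X: "X \<in> sets ?M" "prob X \<le> sqrt 2 / (real m * real n)\<^sup>2"
  proof -
    have "0 < m" "0 < n" using mn by auto
    note bounded = gauss_matrix_entries_bounded[OF this meta_eq_to_obj_eq[OF K_def]]
    show "X \<in> sets ?M" "prob X \<le> sqrt 2 / (real m * real n)\<^sup>2"
      unfolding X_def by (fact bounded)+
  qed
  have Y: "Y \<in> sets ?M"
    unfolding Y_def using Bad(1) by (intro sets.finite_UN) auto
  have "prob Y \<le> (\<Sum>D\<in>Pow {..<n}. prob (Bad D))"
    unfolding Y_def using Bad(1) by (intro finite_measure_subadditive_finite) auto
  also have "\<dots> \<le> (\<Sum>D\<in>Pow {..<n}. 2 / (3 * real m * 2 ^ n))"
    by (intro sum_mono Bad(2))
  also have "\<dots> = 2 / (3 * real m)"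
    by (simp add: card_Pow)
  finally have pY: "prob Y \<le> 2 / (3 * real m)" .
  have sum: "sqrt 2 / (real m * real n)\<^sup>2 + 2 / (3 * real m) \<le> 1 / real m"
    using entries_bound_le[OF mn] mn by (simp add: field_simps)
  note E = event_of_bad_sets[OF prob_space_axioms X(1) Y X(2) pY sum]
  show ?thesis
  proof (rule that[OF E])
    fix G z assume G: "G \<in> space ?M - (X \<union> Y)"
      and less: "zAR m n A (\<lambda>i j. \<bar>G (i, j)\<bar>) c (\<lambda>_. dbar) U < ereal z"
    have GK: "\<bar>G (i, j)\<bar> \<le> K" if "i < m" "j < n" for i j
      using G that by (force simp: X_def)
    have "0 \<le> zAR m n A (\<lambda>i j. \<bar>G (i, j)\<bar>) c (\<lambda>_. dbar) U"
      using c d U by (intro zAR_nonneg) auto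
    then have "0 < ereal z" using less by (rule le_less_trans)
    then have z: "0 < z" by simp
    obtain x where x: "\<And>j. j < n \<Longrightarrow> 0 \<le> x j" "(\<Sum>j<n. c j * x j) \<le> z"
      "\<And>h i b. h \<in> U \<Longrightarrow> i < m \<Longrightarrow> (\<And>j. j < n \<Longrightarrow> \<bar>G (i, j)\<bar> \<le> b) \<Longrightarrow> 0 \<le> b \<Longrightarrow>
         h i \<le> (\<Sum>j<n. A i j * x j) + b * (z / dbar)"
      using zAR_lessD[OF c d U less] by blast
    have n0: "0 < n" using mn by simp
    obtain D where D: "D \<subseteq> {..<n}" "\<And>j. j < n \<Longrightarrow> c j \<noteq> 0 \<Longrightarrow> x j \<le> z * v D j"
        "(\<Sum>j<n. c j * v D j) \<le> 2 * t"
      using rounding_of_first_stage[OF n0 z t c x(1,2)] unfolding v_def by blast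
    have val: "\<exists>j<n. mu i * (1 / z) - w D i \<le> \<bar>G (i, j)\<bar>" if i: "i < m" for i
    proof -
      obtain k where k: "k < n" "\<And>j. j < n \<Longrightarrow> \<bar>G (i, j)\<bar> \<le> \<bar>G (i, k)\<bar>"
        using abs_entry_attaining_max[OF n0] by blast
      show ?thesis
      proof (cases "\<exists>j<n. c j = 0 \<and> 0 < A i j")
        case True
        then have "mu i = 0" by (simp add: mu_def)
        then show ?thesis using k(1) w0[OF i, of D] by (intro exI[of _ k]) auto
      next
        case False
        \<comment> \<open>The bound by the row maximum holds for all \<open>h\<close> with the same
          \<open>x\<close>, so it passes to the supremum \<open>M i\<close>.\<close>
        have "M i \<le> (\<Sum>j<n. A i j * x j) + \<bar>G (i, k)\<bar> * (z / dbar)"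
          unfolding M_def using U k i by (intro cSUP_least x(3)) auto
        also have "(\<Sum>j<n. A i j * x j) \<le> (\<Sum>j<n. z * (A i j * v D j))"
        proof (intro sum_mono)
          fix j assume "j \<in> {..<n}"
          then have j: "j < n" by simp
          show "A i j * x j \<le> z * (A i j * v D j)"
          proof (cases "c j = 0")
            case True
            \<comment> \<open>In such a row the free columns have zero coefficient, so setting
              \<open>v D j = 0\<close> there loses nothing.\<close>
            then have "A i j = 0" using False A[OF i j] j by force
            then show ?thesis by simp
          next
            case False
            then show ?thesis using mult_left_mono[OF D(2)[OF j False] A[OF i j]] by (simp add: mult_ac)
          qed
        qed
        also have "\<dots> = z * (\<Sum>j<n. A i j * v D j)" by (rule sum_distrib_left[symmetric])
        finally have "M i \<le> z * (\<Sum>j<n. A i j * v D j) + \<bar>G (i, k)\<bar> * (z / dbar)" by simp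
        then have "(dbar / z) * M i \<le> (dbar / z) * (z * (\<Sum>j<n. A i j * v D j) + \<bar>G (i, k)\<bar> * (z / dbar))"
          using d z by (intro mult_left_mono) auto
        also have "\<dots> = w D i + \<bar>G (i, k)\<bar>"
          using d z by (simp add: w_def distrib_left)
        finally have "(dbar / z) * M i \<le> w D i + \<bar>G (i, k)\<bar>" .
        have "mu i * (1 / z) - w D i \<le> \<bar>G (i, k)\<bar>"
        proof -
          have "mu i = dbar * M i" using False unfolding mu_def by (rule if_not_P)
          then show ?thesis using \<open>(dbar / z) * M i \<le> w D i + \<bar>G (i, k)\<bar>\<close> by simp
        qed
        then show ?thesis using k by blast
      qed
    qed
    have "G \<in> space ?M - Bad D" using G D(1) by (auto simp: Y_def)
    moreover have "0 \<le> 1 / z" using z by simp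
    ultimately have few: "card {i. i < m \<and> 3 * exp 6 * K * (\<Sum>j<n. \<bar>G (i, j)\<bar>) < real n * (mu i * (1 / z) - w D i)} < T"
      using good[of D] GK val unfolding good_def by blast
    have "zAff m n A (\<lambda>i j. \<bar>G (i, j)\<bar>) c (\<lambda>_. dbar) U
        \<le> ereal ((\<Sum>j<n. c j * v D j) * z + (3 * exp 6 * K + real T) * z)"
    proof (rule static_policy_from_candidate[where M = M and mu = mu and w = "w D"])
      show "0 \<le> 3 * exp 6 * K" using K by simp
      show "card {i. i < m \<and> 3 * exp 6 * K * (\<Sum>j<n. \<bar>G (i, j)\<bar>) < real n * (mu i * (1 / z) - w D i)} \<le> T"
        using few by (rule less_imp_le)
    qed (use n0 d z A v M M0 val in \<open>simp_all only: mu_def w_def\<close>)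
    also have "\<dots> \<le> ereal ((2 * sqrt (ln (real m)) + 3 * exp 6 * K + real T) * z)"
      using mult_right_mono[OF D(3), of z] z by (simp add: t_def algebra_simps)
    finally show "zAff m n A (\<lambda>i j. \<bar>G (i, j)\<bar>) c (\<lambda>_. dbar) U
        \<le> ereal ((2 * sqrt (ln (real m)) + 3 * exp 6 * K + real T) * z)" .
  qed
qed

text \<open>The third regime determines the constant: \<open>2 * r\<close> for the first stage,
  \<open>12 * exp 6 * r\<close> for the constant part and \<open>2 * r\<close> for the deficient
  rows.\<close>

lemma affine_bound:
  assumes mn: "3 \<le> m" "3 \<le> n"
    and A: "\<And>i j. i < m \<Longrightarrow> j < n \<Longrightarrow> 0 \<le> A i j"
    and c: "\<And>j. j < n \<Longrightarrow> 0 \<le> c j" and d: "0 < dbar" and U: "U \<noteq> {}"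
    and bdd: "\<And>i. i < m \<Longrightarrow> bdd_above ((\<lambda>h. h i) ` U)"
    and U0: "\<forall>h\<in>U. \<forall>i<m. 0 \<le> h i"
  defines "kappa \<equiv> (4 + 12 * exp 6) * sqrt (ln (real m) + ln (real n))"
  obtains E where "E \<in> sets (gauss_matrix m n)" "1 - 1 / real m \<le> measure (gauss_matrix m n) E"
    "\<And>G. G \<in> E \<Longrightarrow> zAff m n A (\<lambda>i j. \<bar>G (i, j)\<bar>) c (\<lambda>_. dbar) U
        \<le> ereal kappa * zAR m n A (\<lambda>i j. \<bar>G (i, j)\<bar>) c (\<lambda>_. dbar) U"
proof -
  let ?M = "gauss_matrix m n"
  let ?AR = "\<lambda>G. zAR m n A (\<lambda>i j. \<bar>G (i, j)\<bar>) c (\<lambda>_. dbar) U"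
  let ?Aff = "\<lambda>G. zAff m n A (\<lambda>i j. \<bar>G (i, j)\<bar>) c (\<lambda>_. dbar) U"
  interpret prob_space ?M by (rule prob_space_gauss_matrix)
  define r where "r = sqrt (ln (real m) + ln (real n))"
  define K where "K = sqrt (12 * (ln (real m) + ln (real n)))"
  have ln1: "1 \<le> ln (real k)" if "3 \<le> k" for k :: nat
  proof -
    have "exp 1 \<le> real k" using exp_le that by linarith
    then show ?thesis using that by (subst ln_ge_iff) auto
  qed
  have "1 \<le> ln (real m)" "1 \<le> ln (real n)" using ln1 mn by auto
  have r: "1 \<le> r" "sqrt (ln (real m)) \<le> r"
    unfolding r_def using \<open>1 \<le> ln (real m)\<close> \<open>1 \<le> ln (real n)\<close> by auto
  have K: "0 \<le> K" "K \<le> 4 * r"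
  proof -
    have "sqrt 12 \<le> 4" by (intro real_le_lsqrt) auto
    then have "sqrt 12 * r \<le> 4 * r" using r by (intro mult_right_mono) auto
    then show "K \<le> 4 * r" unfolding K_def r_def real_sqrt_mult by simp
    show "0 \<le> K" using \<open>1 \<le> ln (real m)\<close> \<open>1 \<le> ln (real n)\<close> by (simp add: K_def)
  qed
  have kappa: "kappa = (4 + 12 * exp 6) * r" by (simp add: kappa_def r_def)
  have kappa0: "0 < kappa" unfolding kappa using r by (intro mult_pos_pos add_pos_pos) auto
  have AR0: "0 \<le> ?AR G" for G using c d U by (intro zAR_nonneg) auto
  have finish: "?Aff G \<le> ereal kappa * ?AR G"
    if b: "\<And>z. ?AR G < ereal z \<Longrightarrow> ?Aff G \<le> ereal (b * z)" and le: "b \<le> kappa" for G b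
  proof (rule zAff_le_scaled_zAR[OF kappa0 AR0])
    fix z assume less: "?AR G < ereal z"
    then have "0 < ereal z" using AR0 by (rule le_less_trans[rotated])
    then have "b * z \<le> kappa * z" using le by (intro mult_right_mono) auto
    then show "?Aff G \<le> ereal (kappa * z)" using b[OF less] by (meson ereal_less_eq(3) order_trans)
  qed
  have m1: "1 \<le> m" and n0: "0 < n" using mn by auto
  consider "(real n)\<^sup>2 \<le> ln (real m)" | "ln (real m) \<le> real n"
    | "real n \<le> ln (real m)" "ln (real m) \<le> (real n)\<^sup>2" by linarith
  then show ?thesis
  proof cases
    case 1
    then have "real n \<le> sqrt (ln (real m))" by (rule real_le_rsqrt)
    then have "1 + real n \<le> 2 * r" using r by linarith
    also have "\<dots> \<le> kappa" unfolding kappa using r by (intro mult_right_mono) auto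
    finally have "1 + real n \<le> kappa" .
    then have "?Aff G \<le> ereal kappa * ?AR G" for G
      by (intro finish[of G "1 + real n"] zAff_bound_few_columns[OF n0 _ d U]) (use c in auto)
    then show ?thesis
      \<comment> \<open>The bound is deterministic in this regime, so the event is the whole
        space.\<close>
      by (intro that[of "space ?M"]) (simp_all add: prob_space)
  next
    case 2
    have "K / exp (-4) = exp 4 * K" by (simp add: exp_minus field_simps)
    also have "\<dots> \<le> exp 6 * (4 * r)" using K r by (intro mult_mono) auto
    finally have "1 + K / exp (-4) \<le> r + 4 * exp 6 * r" using r by linarith
    also have "\<dots> = (1 + 4 * exp 6) * r" by (simp add: algebra_simps)
    also have "\<dots> \<le> kappa" unfolding kappa using r by (intro mult_right_mono add_mono) auto
    finally have le: "1 + K / exp (-4) \<le> kappa" .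
    obtain E where "E \<in> sets ?M" "1 - 1 / real m \<le> prob E"
      "\<And>G z. G \<in> E \<Longrightarrow> ?AR G < ereal z \<Longrightarrow> ?Aff G \<le> ereal ((1 + K / exp (-4)) * z)"
      using affine_bound_many_columns[of m n c dbar U A, OF m1 mn(2) 2 c d U, folded K_def] by blast
    then show ?thesis using that finish le by blast
  next
    case 3
    \<comment> \<open>The least integer with \<open>ln m \<le> n * T\<close>. Since
      \<open>sqrt (ln m) \<le> n\<close>, it is at most \<open>sqrt (ln m) + 1\<close>, hence at
      most \<open>2 * r\<close>.\<close>
    define T where "T = nat \<lceil>ln (real m) / real n\<rceil>"
    have q: "1 \<le> ln (real m) / real n" using 3 n0 by (simp add: field_simps)
    have Tlo: "ln (real m) / real n \<le> real T" unfolding T_def by linarith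
    have Tup: "real T \<le> ln (real m) / real n + 1" unfolding T_def using q by linarith
    have T: "ln (real m) \<le> real n * real T" "0 < T"
      using Tlo q n0 by (auto simp: field_simps intro: Nat.gr0I)
    have s: "sqrt (ln (real m)) \<le> real n"
      using 3 by (intro real_le_lsqrt) auto
    have "ln (real m) = sqrt (ln (real m)) * sqrt (ln (real m))"
      using \<open>1 \<le> ln (real m)\<close> by simp
    also have "\<dots> \<le> sqrt (ln (real m)) * real n"
      using s \<open>1 \<le> ln (real m)\<close> by (intro mult_left_mono) auto
    finally have "ln (real m) / real n \<le> sqrt (ln (real m))"
      using n0 by (simp add: field_simps)
    then have "real T \<le> 2 * r" using Tup r by linarith
    moreover have "3 * exp 6 * K \<le> 3 * exp 6 * (4 * r)" using K by (intro mult_left_mono) auto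
    ultimately have "2 * sqrt (ln (real m)) + 3 * exp 6 * K + real T \<le> 2 * r + 12 * exp 6 * r + 2 * r"
      using r by linarith
    also have "\<dots> = kappa" by (simp add: kappa algebra_simps)
    finally have le: "2 * sqrt (ln (real m)) + 3 * exp 6 * K + real T \<le> kappa" .
    obtain E where "E \<in> sets ?M" "1 - 1 / real m \<le> prob E"
      "\<And>G z. G \<in> E \<Longrightarrow> ?AR G < ereal z \<Longrightarrow>
         ?Aff G \<le> ereal ((2 * sqrt (ln (real m)) + 3 * exp 6 * K + real T) * z)"
      using affine_bound_intermediate[of m n A c dbar U T, OF m1 mn(2) 3 A c d U bdd U0 T, folded K_def]
      by blast
    then show ?thesis using that finish le by blast
  qed
qed

theorem theorem2:
  shows "\<exists>C>0. \<exists>N::nat. \<forall>m n. 1 \<le> m \<and> 1 \<le> n \<and> N \<le> m \<and> N \<le> n \<longrightarrow>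
    (\<forall>(L::nat) (A::nat \<Rightarrow> nat \<Rightarrow> real) (c::nat \<Rightarrow> real) (dbar::real)
        (R::nat \<Rightarrow> nat \<Rightarrow> real) (r::nat \<Rightarrow> real).
      (\<forall>i<m. \<forall>j<n. 0 \<le> A i j) \<and> (\<forall>j<n. 0 \<le> c j) \<and> 0 < dbar \<and>
      (\<forall>l<L. \<forall>i<m. 0 \<le> R l i) \<and> (\<forall>l<L. 0 \<le> r l) \<and> compact (polyU m L R r)
      \<longrightarrow>
      (\<exists>E\<in>sets (gauss_matrix m n).
         measure (gauss_matrix m n) E \<ge> 1 - 1 / real m \<and>
         (\<forall>G\<in>E.
            let B = (\<lambda>i j. \<bar>G (i, j)\<bar>);
                d = (\<lambda>j. dbar);
                U = polyU m L R r;
                kappa = C * sqrt (ln (real m) + ln (real n))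
            in zAR m n A B c d U \<le> zAff m n A B c d U \<and>
               zAff m n A B c d U \<le> ereal kappa * zAR m n A B c d U)))"
proof (intro exI[of _ "4 + 12 * exp 6"] conjI exI[of _ 3] allI impI)
  show "0 < 4 + 12 * exp (6::real)" by (intro add_pos_pos) auto
  fix m n L :: nat and A R :: "nat \<Rightarrow> nat \<Rightarrow> real" and c r :: "nat \<Rightarrow> real" and dbar :: real
  assume mn: "1 \<le> m \<and> 1 \<le> n \<and> 3 \<le> m \<and> 3 \<le> n"
    and as: "(\<forall>i<m. \<forall>j<n. 0 \<le> A i j) \<and> (\<forall>j<n. 0 \<le> c j) \<and> 0 < dbar \<and>
      (\<forall>l<L. \<forall>i<m. 0 \<le> R l i) \<and> (\<forall>l<L. 0 \<le> r l) \<and> compact (polyU m L R r)"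
  have m3: "3 \<le> m" and n3: "3 \<le> n" and d0: "0 < dbar" using mn as by blast+
  have A0: "0 \<le> A i j" if "i < m" "j < n" for i j using as that by blast
  have c0: "0 \<le> c j" if "j < n" for j using as that by blast
  \<comment> \<open>Nonnegativity of \<open>r\<close> puts the zero vector into the uncertainty set;
    over an empty set the suprema would be minus infinity.\<close>
  have U: "polyU m L R r \<noteq> {}" using zero_in_polyU as by blast
  have U0: "\<forall>h\<in>polyU m L R r. \<forall>i<m. 0 \<le> h i"
    by (simp add: polyU_def)
  have bdd: "bdd_above ((\<lambda>h. h i) ` polyU m L R r)" if "i < m" for i
    using as by (intro polyU_coordinate_bounded) blast
  obtain E where "E \<in> sets (gauss_matrix m n)" "1 - 1 / real m \<le> measure (gauss_matrix m n) E"
    "\<And>G. G \<in> E \<Longrightarrow> zAff m n A (\<lambda>i j. \<bar>G (i, j)\<bar>) c (\<lambda>_. dbar) (polyU m L R r)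
        \<le> ereal ((4 + 12 * exp 6) * sqrt (ln (real m) + ln (real n)))
          * zAR m n A (\<lambda>i j. \<bar>G (i, j)\<bar>) c (\<lambda>_. dbar) (polyU m L R r)"
    using affine_bound[of m n A c dbar "polyU m L R r", OF m3 n3 A0 c0 d0 U bdd U0] by blast
  then show "\<exists>E\<in>sets (gauss_matrix m n).
         measure (gauss_matrix m n) E \<ge> 1 - 1 / real m \<and>
         (\<forall>G\<in>E.
            let B = (\<lambda>i j. \<bar>G (i, j)\<bar>);
                d = (\<lambda>j. dbar);
                U = polyU m L R r;
                kappa = (4 + 12 * exp 6) * sqrt (ln (real m) + ln (real n))
            in zAR m n A B c d U \<le> zAff m n A B c d U \<and>
               zAff m n A B c d U \<le> ereal kappa * zAR m n A B c d U)"
    unfolding Let_def using zAR_le_zAff by (intro bexI[of _ E]) auto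
qed

end
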